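(* Consider the actual platoon (AP), reference platoon (RP) and virtual platoon (VP) with the adaptive control laws described in the context. Then the state tracking error $\tilde x_j=x_j-x_{r,j}$ asymptotically converges to zero, i.e. $\lim_{t\to\infty}(x_j(t)-x_{r,j}(t))=0$ for all $j\in\alpha_N$.
   Context: Notation: $\|\eta\|_M=\sqrt{\eta^TM\eta}$ for $M=M^T>0$. $N\ge1$, $\alpha_N=\{1,\dots,N\}$; index $0$ is the leader. Constants $h,k_p,k_d,\bar\tau>0$ with $k_d>\bar\tau k_p$; $c>0$ is a user-chosen constant. $u_{in}:[0,\infty)\to\mathbb R$ is a bounded external input (desired leader acceleration), such that when $\lim_{t\to\infty}u_{in}(t)=0$, which implies that the VP leader acceleration $a_{v,0}(t)$ tends to $0$, the limit $v_{c,new}=\lim_{t\to\infty}v_{v,0}(t)$ of the VP leader velocity exists and is finite. For $j\in\alpha_N\cup\{0\}$, $\tau_j>0,\Lambda_j>0$ are unknown constants, $\theta_j=\Lambda_j/\tau_j$. Barrier function: $\psi(r)=\frac{r^2}{c-r}$ for $0\le r<c$, and $\psi'(r)=\frac{d\psi}{d(r^2)}=\frac{2c-r}{2(c-r)^2}$. Matrices: $$A_m=\begin{bmatrix}0&-1&-h&0\\0&0&1&0\\0&0&-1/\bar\tau&1/\bar\tau\\k_p/h&-k_d/h&-k_d&-1/h\end{bmatrix},\quad A_j=\begin{bmatrix}0&-1&-h&0\\0&0&1&0\\0&0&-1/\tau_j&\Lambda_j/\tau_j\\k_p/h&-k_d/h&-k_d&-1/h\end{bmatrix},\quad B_w=\begin{bmatrix}1&0\\0&0\\0&0\\k_d/h&1/h\end{bmatrix},\quad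 B_u=\begin{bmatrix}0\\0\\1\\0\end{bmatrix}.$$ Followers ($j\in\alpha_N$), with states $x_j=(e_j,v_j,a_j,u_{bl,j})^T$ (spacing error, velocity, acceleration, baseline control), $x_{r,j}=(e_{r,j},v_{r,j},a_{r,j},u_{bl,r,j})^T$, $x_{v,j}=(e_{v,j},v_{v,j},a_{v,j},u_{bl,v,j})^T$ and signals $w_{j}=(v_{j},u_{bl,j})^T$, $w_{v,j}=(v_{v,j},u_{bl,v,j})^T$: - AP: $\dot x_j=A_jx_j+B_ww_{j-1}+B_u\theta_ju_{ad,j}$; - RP: $\dot x_{r,j}=A_mx_{r,j}+B_ww_{j-1}$ (driven by the AP signal $w_{j-1}$), $x_{r,j}(0)=x_{v,j}(0)$; - VP: $\dot x_{v,j}=A_mx_{v,j}+B_ww_{v,j-1}$. Leaders, with $\underline x_0=(v_0,a_0,u_{bl,0})^T$, $\underline x_{r,0}=(v_{r,0},a_{r,0},u_{bl,r,0})^T$, $\underline x_{v,0}=(v_{v,0},a_{v,0},u_{bl,v,0})^T$: - VP and RP leaders coincide, $\underline x_{r,0}(t)=\underline x_{v,0}(t)$ for all $t\ge0$, and satisfy $\dot{\underline x}_{r,0}=\underline A_{m,0}\underline x_{r,0}+\underline B_ru_{in}$, $\underline A_{m,0}=\begin{bmatrix}0&1&0\\0&-1/\bar\tau&1/\bar\tau\\0&0&-1/h\end{bmatrix}$, $\underline B_r=(0,0,1/h)^T$; - AP leader: $\dot{\underline x}_0=\underline A_0\underline x_0+\underline B_u\theta_0u_{ad,0}+\underline B_ru_{in}$,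 $\underline A_0=\begin{bmatrix}0&1&0\\0&-1/\tau_0&\Lambda_0/\tau_0\\0&0&-1/h\end{bmatrix}$, $\underline B_u=(0,1,0)^T$. Adaptive laws: $u_{ad,j}=\hat k_{x,j}^Tx_j$, $\dot{\hat k}_{x,j}=-\Gamma_{x,j}\psi'(\|\tilde x_j\|_{P_m})x_j\tilde x_j^TP_mB_u$ for $j\in\alpha_N$, where $A_m^TP_m+P_mA_m=-Q_m$ with $P_m=P_m^T>0$, $Q_m=Q_m^T>0$. For the leader, $\tilde{\underline x}_0=\underline x_0-\underline x_{r,0}$, $u_{ad,0}=\hat k_{\underline x_0}^T\underline x_0+\hat k_{\tilde{\underline x}_0}^T\tilde{\underline x}_0$, $\dot{\hat k}_{\underline x_0}=-\Gamma_{\underline x_0}\psi'(\|\tilde{\underline x}_0\|_{P_{m,0}})\underline x_0\tilde{\underline x}_0^TP_{m,0}\underline B_u$, $\dot{\hat k}_{\tilde{\underline x}_0}=-\Gamma_{\tilde{\underline x}_0}\psi'(\|\tilde{\underline x}_0\|_{P_{m,0}})\tilde{\underline x}_0\tilde{\underline x}_0^TP_{m,0}\underline B_u$, where $\underline A_c=\begin{bmatrix}0&1&0\\\beta_1&\beta_2&\beta_3\\0&0&-1/h\end{bmatrix}$ with chosen $\beta_1<0,\beta_2<0,\beta_3\in\mathbb R$, and $\underline A_c^TP_{m,0}+P_{m,0}\underline A_c=-Q_c$ with $P_{m,0}=P_{m,0}^T>0$, $Q_c=Q_c^T>0$. The adaptation gains $\Gamma$ are symmetric positive definite matrices. *)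

theory Defs
  imports "HOL-Analysis.Analysis"
begin

definition sym_pos_def :: "real^'n^'n \<Rightarrow> bool" where
  "sym_pos_def M \<longleftrightarrow> transpose M = M \<and> (\<forall>x. x \<noteq> 0 \<longrightarrow> 0 < x \<bullet> (M *v x))"

definition weighted_norm :: "real^'n^'n \<Rightarrow> real^'n \<Rightarrow> real" where
  "weighted_norm M x = sqrt (x \<bullet> (M *v x))"

definition barrier :: "real \<Rightarrow> real \<Rightarrow> real" where
  "barrier c r = r\<^sup>2 / (c - r)"

(* The derivative of the barrier with respect to r^2, not r; see barrier_has_derivative.
   Only meaningful for 0 <= r < c. *)
definition barrier' :: "real \<Rightarrow> real \<Rightarrow> real" where
  "barrier' c r = (2 * c - r) / (2 * (c - r)\<^sup>2)"

lemma barrier_has_derivative: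
  assumes "0 < r" "r < c"
  shows "((\<lambda>s. barrier c (sqrt s)) has_real_derivative barrier' c r) (at (r\<^sup>2))"
proof -
  have "((\<lambda>s. (sqrt s)\<^sup>2 / (c - sqrt s)) has_real_derivative
      ((2 * r * (inverse r / 2)) * (c - r) - r\<^sup>2 * (- (inverse r / 2))) / ((c - r) * (c - r)))
      (at (r\<^sup>2))"
    using assms by (auto intro!: derivative_eq_intros simp: real_sqrt_abs)
  moreover have "((2 * r * (inverse r / 2)) * (c - r) - r\<^sup>2 * (- (inverse r / 2))) / ((c - r) * (c - r))
      = barrier' c r"
    using assms by (simp add: barrier'_def field_simps power2_eq_square)
  ultimately show ?thesis
    by (simp add: barrier_def)
qed

(* "x has derivative f on [0, oo)" in integrated form. This includes Caratheodory solutions,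
   so that discontinuous inputs such as steps are admitted. *)
definition evolves :: "(real \<Rightarrow> 'a::real_normed_vector) \<Rightarrow> (real \<Rightarrow> 'a) \<Rightarrow> bool" where
  "evolves x f \<longleftrightarrow> (\<forall>t\<ge>0. (f has_integral (x t - x 0)) {0..t})"

lemma evolves_if_has_vector_derivative:
  fixes x :: "real \<Rightarrow> 'a::banach"
  assumes "\<And>t. t \<ge> 0 \<Longrightarrow> (x has_vector_derivative f t) (at t within {0..})"
  shows "evolves x f"
  unfolding evolves_def
proof (intro allI impI)
  fix t :: real assume "0 \<le> t"
  then show "(f has_integral (x t - x 0)) {0..t}"
    by (intro fundamental_theorem_of_calculus)
       (auto intro: has_vector_derivative_within_subset[OF assms])
qed

(* Follower state: (spacing error, velocity, acceleration, baseline control).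
   The vehicle parameters of the reference model are tau = taubar and Lam = 1. *)
definition A_fol :: "real \<Rightarrow> real \<Rightarrow> real \<Rightarrow> real \<Rightarrow> real \<Rightarrow> real^4^4" where
  "A_fol h kp kd tau Lam = vector
    [vector [0, -1, -h, 0],
     vector [0, 0, 1, 0],
     vector [0, 0, -1 / tau, Lam / tau],
     vector [kp / h, -kd / h, -kd, -1 / h]]"

definition A_m :: "real \<Rightarrow> real \<Rightarrow> real \<Rightarrow> real \<Rightarrow> real^4^4" where
  "A_m h kp kd taubar = A_fol h kp kd taubar 1"

definition B_w :: "real \<Rightarrow> real \<Rightarrow> real^2^4" where
  "B_w h kd = vector [vector [1, 0], vector [0, 0], vector [0, 0], vector [kd / h, 1 / h]]"

definition B_u :: "real^4" where
  "B_u = vector [0, 0, 1, 0]"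

(* Leader state: (velocity, acceleration, baseline control). *)
definition A_lead :: "real \<Rightarrow> real \<Rightarrow> real \<Rightarrow> real^3^3" where
  "A_lead h tau Lam = vector
    [vector [0, 1, 0],
     vector [0, -1 / tau, Lam / tau],
     vector [0, 0, -1 / h]]"

definition A_m0 :: "real \<Rightarrow> real \<Rightarrow> real^3^3" where
  "A_m0 h taubar = A_lead h taubar 1"

definition A_c :: "real \<Rightarrow> real \<Rightarrow> real \<Rightarrow> real \<Rightarrow> real^3^3" where
  "A_c h \<beta>1 \<beta>2 \<beta>3 = vector [vector [0, 1, 0], vector [\<beta>1, \<beta>2, \<beta>3], vector [0, 0, -1 / h]]"

definition B_r0 :: "real \<Rightarrow> real^3" where
  "B_r0 h = vector [0, 0, 1 / h]"

definition B_u0 :: "real^3" where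
  "B_u0 = vector [0, 1, 0]"

(* The pair (velocity, baseline control) that vehicle j of a platoon, with leader state x0 and
   follower states x, transmits to its successor. *)
definition w_signal :: "(real \<Rightarrow> real^3) \<Rightarrow> (nat \<Rightarrow> real \<Rightarrow> real^4) \<Rightarrow> nat \<Rightarrow> real \<Rightarrow> real^2" where
  "w_signal x0 x j t =
    (if j = 0 then vector [x0 t $ 1, x0 t $ 3] else vector [x j t $ 2, x j t $ 4])"

(* Right-hand side of the adaptive laws: gain G, Lyapunov matrix P, input vector B,
   regressor phi, tracking error e. *)
definition adaptation ::
  "real \<Rightarrow> real^'n^'n \<Rightarrow> real^'n^'n \<Rightarrow> real^'n \<Rightarrow> real^'n \<Rightarrow> real^'n \<Rightarrow> real^'n" where
  "adaptation c G P B \<phi> e = - ((barrier' c (weighted_norm P e) * (e \<bullet> (P *v B))) *\<^sub>R (G *v \<phi>))"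

end

theory Submission
  imports Defs "HOL-Library.Landau_Symbols"
begin

text \<open>
  The barrier plus a quadratic form in the parameter errors is a nonincreasing function \<open>V\<close> with
  \<open>V' \<le> - q * (norm y)\<^sup>2\<close>, where \<open>y\<close> is the tracking error. Hence \<open>y\<close> stays inside the barrier and the
  adaptive gains are bounded.

  The regressor \<open>\<phi>\<close> is the vehicle state, which need not be bounded, because a bounded leader
  acceleration command does not bound the velocity. However, the transmitted signals are
  Lipschitz: this holds for the leader and passes from each vehicle to the next, since the
  reference model is a stable linear system. Therefore \<open>\<phi>' = p + \<theta> * \<eta> *\<^sub>R d\<close> with \<open>p\<close> bounded and
  \<open>\<eta> = k \<bullet> \<phi>\<close>, where \<open>k\<close> is the parameter error.

  Let \<open>\<mu>\<close> be the quadratic form of the adaptation gain at \<open>\<phi>\<close>. The energy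
  \<open>J = barrier + \<theta> * \<eta>\<^sup>2 / (1 + \<mu>)\<close> has a bounded derivative, and for
  \<open>F = (y \<bullet> P b) * \<eta> / (1 + \<mu>)\<close> both \<open>F\<close> and the negative part of \<open>F' - \<beta> * J\<close> are \<open>O(norm y)\<close>.
  Since \<open>norm y\<close> is square integrable, the integrals of \<open>J\<close> over short windows tend to \<open>0\<close>, so
  \<open>J\<close> tends to \<open>0\<close> and with it \<open>y\<close>.
\<close>

subsection \<open>Real analysis\<close>

text \<open>Take the last time up to \<open>t\<close> at which \<open>f\<close> is at most
  \<open>K\<close>: after it \<open>f\<close> exceeds \<open>K\<close>, so \<open>dec\<close>
  applies. The hypothesis speaks of increments instead of derivatives, so that it also covers
  solutions in integrated form.\<close>

lemma nonincreasing_above_imp_bounded: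
  fixes f :: "real \<Rightarrow> real"
  assumes cont: "continuous_on {0..} f" and "f 0 \<le> K"
    and dec: "\<And>s t. 0 \<le> s \<Longrightarrow> s < t \<Longrightarrow> (\<And>r. s < r \<Longrightarrow> r \<le> t \<Longrightarrow> K < f r) \<Longrightarrow> f t \<le> f s"
    and "0 \<le> t"
  shows "f t \<le> K"
proof (rule ccontr)
  assume t: "\<not> f t \<le> K"
  define S where "S = {r \<in> {0..t}. f r \<le> K}"
  have "continuous_on {0..t} f"
    by (rule continuous_on_subset[OF cont]) auto
  then have "closed S"
    unfolding S_def by (intro continuous_on_closed_Collect_le) auto
  then have "compact S"
    unfolding S_def compact_eq_bounded_closed by (auto intro: bounded_subset[OF bounded_closed_interval])
  moreover have "S \<noteq> {}"
    using assms by (auto simp: S_def)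
  ultimately obtain s where s: "s \<in> S" "\<And>r. r \<in> S \<Longrightarrow> r \<le> s"
    using compact_attains_sup[of S] by blast
  have "f t \<le> f s"
  proof (rule dec)
    show "s < t"
      using s(1) t by (cases "s = t") (auto simp: S_def)
    show "K < f r" if "s < r" "r \<le> t" for r
      using that s by (fastforce simp: S_def)
  qed (use s in \<open>auto simp: S_def\<close>)
  then show False
    using s t by (auto simp: S_def)
qed

text \<open>A continuation argument: the bound \<open>R\<close> may be derived under the provisional
  assumption that \<open>r\<close> has stayed below \<open>c\<close>, because a continuous
  \<open>r\<close> cannot jump over the gap between \<open>R\<close> and \<open>c\<close>.\<close>

lemma gap_imp_bounded:
  fixes r :: "real \<Rightarrow> real"
  assumes cont: "continuous_on {0..} r" and "R < c" "r 0 < c"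
    and gap: "\<And>T. 0 \<le> T \<Longrightarrow> (\<And>t. 0 \<le> t \<Longrightarrow> t \<le> T \<Longrightarrow> r t < c) \<Longrightarrow> r T \<le> R"
    and "0 \<le> t"
  shows "r t \<le> R"
proof (rule ccontr)
  assume t: "\<not> r t \<le> R"
  have r0: "r 0 \<le> R"
    using gap[of 0] \<open>r 0 < c\<close> by auto
  \<comment> \<open>A level strictly inside the gap and not above \<open>r t\<close>. At the first
    time at which \<open>r\<close> reaches it, \<open>r\<close> has stayed below \<open>c\<close>,
    so \<open>gap\<close> contradicts \<open>R < d\<close>.\<close>
  define d where "d = min ((R + c) / 2) (r t)"
  have d: "R < d" "d < c" "d \<le> r t"
    using t \<open>R < c\<close> by (auto simp: d_def min_def)
  define S where "S = {s \<in> {0..t}. d \<le> r s}"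
  have cont': "continuous_on {0..u} r" for u
    by (rule continuous_on_subset[OF cont]) auto
  then have "closed S"
    unfolding S_def by (intro continuous_on_closed_Collect_le) auto
  then have "compact S"
    unfolding S_def compact_eq_bounded_closed by (auto intro: bounded_subset[OF bounded_closed_interval])
  moreover have "S \<noteq> {}"
    using d \<open>0 \<le> t\<close> by (auto simp: S_def)
  ultimately obtain T where T: "T \<in> S" "\<And>s. s \<in> S \<Longrightarrow> T \<le> s"
    using compact_attains_inf[of S] by blast
  have below: "r s < d" if "0 \<le> s" "s < T" for s
    using that T by (fastforce simp: S_def)
  obtain s where s: "0 \<le> s" "s \<le> T" "r s = d"
    using IVT'[of r 0 d T] cont'[of T] T(1) r0 d by (auto simp: S_def)
  then have "r T = d"
    using below[of s] by (cases "s = T") auto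
  have "r u < c" if "0 \<le> u" "u \<le> T" for u
    using below[of u] that \<open>r T = d\<close> d(2) by (cases "u = T") auto
  then have "r T \<le> R"
    using T(1) by (intro gap) (auto simp: S_def)
  with \<open>r T = d\<close> d show False
    by simp
qed

text \<open>Integrating against the bump function with zeros at the ends of a short window removes
  the boundary values of \<open>F\<close>, which are bounded but not small.\<close>

lemma virial_tendsto_zero:
  fixes V F J n V' F' J' :: "real \<Rightarrow> real"
  assumes V: "\<And>t. t > 0 \<Longrightarrow> (V has_real_derivative V' t) (at t)"
    and F: "\<And>t. t > 0 \<Longrightarrow> (F has_real_derivative F' t) (at t)"
    and J: "\<And>t. t > 0 \<Longrightarrow> (J has_real_derivative J' t) (at t)"
    and V_nonneg: "\<And>t. t > 0 \<Longrightarrow> 0 \<le> V t" and J_nonneg: "\<And>t. t > 0 \<Longrightarrow> 0 \<le> J t"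
    and V'_le: "\<And>t. t > 0 \<Longrightarrow> V' t \<le> - q * (n t)\<^sup>2" and "0 < q"
    and J'_le: "\<And>t. t > 0 \<Longrightarrow> \<bar>J' t\<bar> \<le> C"
    and F_le: "\<And>t. t > 0 \<Longrightarrow> \<bar>F t\<bar> \<le> C * n t"
    and F'_ge: "\<And>t. t > 0 \<Longrightarrow> \<kappa> * J t - C * n t \<le> F' t" and "0 < \<kappa>"
    and n: "\<And>t. 0 \<le> n t"
  shows "(J \<longlongrightarrow> 0) at_top"
proof (rule ccontr)
  assume "\<not> (J \<longlongrightarrow> 0) at_top"
  then obtain \<epsilon> where "0 < \<epsilon>" and frequent: "\<And>T. \<exists>t\<ge>T. \<epsilon> \<le> \<bar>J t\<bar>"
    unfolding tendsto_iff eventually_at_top_linorder by (auto simp: not_less)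
  have "0 \<le> C"
    using J'_le[of 1] by linarith
  \<comment> \<open>The window is so short that \<open>J\<close>, whose rate of change is at most
    \<open>C\<close>, stays above \<open>\<epsilon> / 2\<close> once it has reached
    \<open>\<epsilon>\<close>. Using \<open>C + 1\<close> keeps the denominators positive.\<close>
  define \<delta> where "\<delta> = min 1 (\<epsilon> / (2 * (C + 1)))"
  have \<delta>: "0 < \<delta>" "\<delta> \<le> 1" "\<delta> * (C + 1) \<le> \<epsilon> / 2"
  proof -
    have "\<delta> \<le> \<epsilon> / (2 * (C + 1))"
      by (simp add: \<delta>_def)
    then show "\<delta> * (C + 1) \<le> \<epsilon> / 2"
      using \<open>0 \<le> C\<close> by (simp add: field_simps)
  qed (use \<open>0 < \<epsilon>\<close> \<open>0 \<le> C\<close> in \<open>auto simp: \<delta>_def\<close>)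
  \<comment> \<open>The integral of \<open>bump\<close> below is \<open>\<delta>^3 / 6\<close>, so
    the term with \<open>J\<close> yields \<open>\<kappa> * \<epsilon> * \<delta>^3 / 12\<close>.
    With this \<open>\<gamma>\<close> the error \<open>(C + 1) * 2 * \<gamma> * \<delta>\<close>
    uses up half of it and leaves \<open>p\<close>. The factor \<open>M\<close> lets the decrease of
    \<open>M * V\<close> pay for the quadratic term in
    \<open>2 * n t \<le> (n t)\<^sup>2 / \<gamma> + \<gamma>\<close>.\<close>
  define \<gamma> where "\<gamma> = \<kappa> * \<epsilon> * \<delta>\<^sup>2 / 48 / (C + 1)"
  have "0 < \<gamma>"
    using \<open>0 < \<epsilon>\<close> \<open>0 \<le> C\<close> \<delta> \<open>0 < \<kappa>\<close> by (auto simp: \<gamma>_def)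
  define M where "M = (C + 1) / (\<gamma> * q)"
  have "0 < M"
    using \<open>0 \<le> C\<close> \<open>0 < \<gamma>\<close> \<open>0 < q\<close> by (auto simp: M_def)
  define p where "p = \<kappa> * \<epsilon> * \<delta>^3 / 24"
  have "0 < p"
    using \<open>0 < \<epsilon>\<close> \<open>0 < \<kappa>\<close> \<delta> by (auto simp: p_def)
  have J_window: "\<epsilon> / 2 \<le> J t" if "a > 0" "\<epsilon> \<le> J a" "a \<le> t" "t \<le> a + \<delta>" for a t
  proof -
    have "J a + C * a \<le> J t + C * t"
    proof (rule DERIV_nonneg_imp_nondecreasing[OF that(3)])
      fix x assume "a \<le> x" "x \<le> t"
      then show "\<exists>y. ((\<lambda>s. J s + C * s) has_real_derivative y) (at x) \<and> 0 \<le> y"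
        using \<open>a > 0\<close> J'_le[of x]
        by (intro exI[of _ "J' x + C"]) (auto intro!: derivative_eq_intros J)
    qed
    moreover have "C * (t - a) \<le> (C + 1) * \<delta>"
      using that \<open>0 \<le> C\<close> by (intro mult_mono) auto
    ultimately show ?thesis
      using that \<delta> by (auto simp: algebra_simps)
  qed
  have drop: "V (a + \<delta>) \<le> V a - p / M" if "a > 0" "\<epsilon> \<le> J a" for a
  proof -
    define bump where "bump t = (t - a) * (a + \<delta> - t)" for t
    define G where "G t = bump t * F t - M * V t - \<kappa> * \<epsilon> / 2 * (\<delta> * (t - a)\<^sup>2 / 2 - (t - a)^3 / 3)
      + (C + 1) * 2 * \<gamma> * (t - a)" for t
    have "G a \<le> G (a + \<delta>)"
    proof (rule DERIV_nonneg_imp_nondecreasing[where f = G])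
      fix t assume t: "a \<le> t" "t \<le> a + \<delta>"
      define y where "y = (a + \<delta> - t - (t - a)) * F t + bump t * F' t - M * V' t
        - \<kappa> * \<epsilon> / 2 * bump t + (C + 1) * 2 * \<gamma>"
      have "(G has_real_derivative y) (at t)"
        unfolding G_def bump_def y_def using t \<open>a > 0\<close>
        by (auto intro!: derivative_eq_intros V F simp: field_simps power2_eq_square)
      moreover have "0 \<le> y"
      proof -
        have bump: "0 \<le> bump t" "bump t \<le> 1"
          using t \<delta> mult_mono[of "t - a" 1 "a + \<delta> - t" 1] by (auto simp: bump_def)
        have "\<bar>(a + \<delta> - t - (t - a)) * F t\<bar> \<le> 1 * (C * n t)"
          unfolding abs_mult using t \<delta> \<open>a > 0\<close> by (intro mult_mono F_le) auto
        moreover have "bump t * (\<kappa> * (\<epsilon> / 2) - C * n t) \<le> bump t * F' t"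
        proof (intro mult_left_mono bump)
          have "\<kappa> * (\<epsilon> / 2) \<le> \<kappa> * J t"
            using J_window[OF that(1,2)] t \<open>0 < \<kappa>\<close> by auto
          then show "\<kappa> * (\<epsilon> / 2) - C * n t \<le> F' t"
            using F'_ge[of t] t \<open>a > 0\<close> by simp
        qed
        moreover have "bump t * (C * n t) \<le> 1 * (C * n t)"
          using bump \<open>0 \<le> C\<close> n by (intro mult_right_mono) auto
        moreover have "M * (q * (n t)\<^sup>2) \<le> - (M * V' t)"
          using mult_left_mono[OF V'_le[of t], of M] t \<open>a > 0\<close> \<open>0 < M\<close> by simp
        moreover have "M * (q * (n t)\<^sup>2) = (C + 1) * ((n t)\<^sup>2 / \<gamma>)"
          using \<open>0 < \<gamma>\<close> \<open>0 < q\<close> by (simp add: M_def)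
        moreover have "(C + 1) * (2 * n t) \<le> (C + 1) * ((n t)\<^sup>2 / \<gamma> + \<gamma>)"
        proof (rule mult_left_mono)
          have "0 \<le> (n t - \<gamma>)\<^sup>2 / \<gamma>"
            using \<open>0 < \<gamma>\<close> by simp
          also have "(n t - \<gamma>)\<^sup>2 / \<gamma> = (n t)\<^sup>2 / \<gamma> + \<gamma> - 2 * n t"
            using \<open>0 < \<gamma>\<close> by (simp add: power2_eq_square field_simps)
          finally show "2 * n t \<le> (n t)\<^sup>2 / \<gamma> + \<gamma>"
            by simp
        qed (use \<open>0 \<le> C\<close> in simp)
        moreover have "0 \<le> (C + 1) * \<gamma>"
          using \<open>0 \<le> C\<close> \<open>0 < \<gamma>\<close> by simp
        ultimately show "0 \<le> y"
          using n[of t] unfolding y_def abs_le_iff by (simp add: algebra_simps)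
      qed
      ultimately show "\<exists>y. (G has_real_derivative y) (at t) \<and> 0 \<le> y"
        by blast
    qed (use \<delta> in simp)
    moreover have "G a = - M * V a"
      by (simp add: G_def bump_def)
    moreover have "G (a + \<delta>) = - M * V (a + \<delta>) - p"
      using \<open>0 \<le> C\<close> \<open>0 < \<kappa>\<close>
      by (simp add: G_def bump_def p_def \<gamma>_def power2_eq_square power3_eq_cube field_simps)
    ultimately show ?thesis
      using \<open>0 < M\<close> by (simp add: field_simps)
  qed
  have V_antimono: "V t \<le> V s" if "0 < s" "s \<le> t" for s t
  proof (rule DERIV_nonpos_imp_nonincreasing[OF that(2)])
    fix x assume x: "s \<le> x" "x \<le> t"
    have "0 \<le> q * (n x)\<^sup>2"
      using \<open>0 < q\<close> by simp
    then show "\<exists>y. (V has_real_derivative y) (at x) \<and> y \<le> 0"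
      using x that V[of x] V'_le[of x] by (intro exI[of _ "V' x"]) auto
  qed
  \<comment> \<open>Windows with large \<open>J\<close> recur forever and each lowers
    \<open>V\<close> by at least \<open>p / M\<close>, whereas \<open>V\<close> stays
    nonnegative.\<close>
  have "\<exists>t>0. V t \<le> V 1 - of_nat m * (p / M)" for m
  proof (induction m)
    case (Suc m)
    then obtain t where t: "t > 0" "V t \<le> V 1 - of_nat m * (p / M)"
      by blast
    obtain a where a: "t \<le> a" "\<epsilon> \<le> \<bar>J a\<bar>"
      using frequent by blast
    then have "V (a + \<delta>) \<le> V a - p / M"
      using t J_nonneg[of a] by (intro drop) auto
    then show ?case
      using V_antimono[of t a] t a \<delta>
      by (intro exI[of _ "a + \<delta>"]) (auto simp: algebra_simps add_divide_distrib)
  next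
    case 0
    show ?case
      by (intro exI[of _ 1]) simp
  qed
  note V_small = this
  obtain m where "V 1 / (p / M) < of_nat m"
    using reals_Archimedean2 by blast
  then have m: "V 1 < of_nat m * (p / M)"
    using \<open>0 < p\<close> \<open>0 < M\<close> by (simp add: field_simps)
  obtain t where "t > 0" "V t \<le> V 1 - of_nat m * (p / M)"
    using V_small by blast
  then show False
    using V_nonneg[of t] m by linarith
qed

subsection \<open>Solutions in integrated form\<close>

lemma evolves_has_integral:
  fixes f :: "real \<Rightarrow> 'a::banach"
  assumes "evolves x f" "0 \<le> s" "s \<le> t"
  shows "(f has_integral x t - x s) {s..t}"
proof -
  have int: "(f has_integral x u - x 0) {0..u}" if "0 \<le> u" for u
    using assms(1) that by (auto simp: evolves_def)
  have "f integrable_on {0..t}"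
    using int[of t] assms by (auto simp: has_integral_integrable)
  then have "f integrable_on {s..t}"
    by (rule integrable_on_subinterval) (use assms in auto)
  moreover have "integral {0..s} f + integral {s..t} f = integral {0..t} f"
    using assms \<open>f integrable_on {0..t}\<close> by (intro Henstock_Kurzweil_Integration.integral_combine) auto
  then have "integral {s..t} f = x t - x s"
    using int[of t] int[of s] assms by (auto simp: integral_unique algebra_simps)
  ultimately show ?thesis
    by (auto simp: has_integral_integrable_integral)
qed

lemma evolves_continuous_on:
  fixes f :: "real \<Rightarrow> 'a::banach"
  assumes "evolves x f"
  shows "continuous_on {0..} x"
  unfolding continuous_on_eq_continuous_within
proof
  fix t :: real assume t: "t \<in> {0..}"
  have int: "(f has_integral x u - x 0) {0..u}" if "0 \<le> u" for u
    using assms that by (auto simp: evolves_def)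
  have "f integrable_on {0..t + 1}"
    using int[of "t + 1"] t by (auto simp: has_integral_integrable)
  then have "continuous_on {0..t + 1} (\<lambda>u. x 0 + integral {0..u} f)"
    by (intro continuous_intros indefinite_integral_continuous_1)
  then have "continuous_on {0..t + 1} x"
    by (rule continuous_on_eq) (use integral_unique[OF int] in auto)
  then have "continuous (at t within {0..t + 1}) x"
    using t by (auto simp: continuous_on_eq_continuous_within)
  moreover have "at t within {0..} = at t within {0..t + 1}"
    by (rule at_within_nhd[of t "{..<t + 1}"]) auto
  ultimately show "continuous (at t within {0..}) x"
    by simp
qed

lemma continuous_on_atLeast_isCont:
  fixes f :: "real \<Rightarrow> 'a::topological_space"
  assumes "continuous_on {a..} f" "a < t"
  shows "isCont f t"
  by (rule continuous_on_interior[OF assms(1)]) (use assms(2) in \<open>simp add: interior_Ici[of "a - 1"]\<close>)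

text \<open>Recovers a classical derivative. The input \<open>u_in\<close> may jump, but it cancels
  from the equation of the leader's tracking error, and the followers only receive continuous
  signals.\<close>

lemma evolves_has_vector_derivative:
  fixes f :: "real \<Rightarrow> 'a::banach"
  assumes "evolves x f" "0 < t" "isCont f t"
  shows "(x has_vector_derivative f t) (at t)"
proof -
  have int: "(f has_integral x u - x 0) {0..u}" if "0 \<le> u" for u
    using assms that by (auto simp: evolves_def)
  have "f integrable_on {0..t + 1}"
    using int[of "t + 1"] assms by (auto simp: has_integral_integrable)
  then have "((\<lambda>u. integral {0..u} f) has_vector_derivative f t) (at t within {0..t + 1} - {})"
    using assms by (intro integral_has_vector_derivative_continuous_at) (auto intro: continuous_at_imp_continuous_within)
  then have "((\<lambda>u. integral {0..u} f) has_vector_derivative f t) (at t)"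
    using assms by (auto simp: at_within_Icc_at)
  then have "((\<lambda>u. x 0 + integral {0..u} f) has_vector_derivative f t) (at t)"
    by (auto intro!: derivative_eq_intros)
  then show ?thesis
    by (rule has_vector_derivative_transform_within_open[where S = "{0<..}"])
      (use assms integral_unique[OF int] in auto)
qed

lemma evolves_linear:
  assumes "evolves x f" "bounded_linear g"
  shows "evolves (\<lambda>t. g (x t)) (\<lambda>t. g (f t))"
  unfolding evolves_def
proof (intro allI impI)
  fix t :: real assume "0 \<le> t"
  then have "(f has_integral x t - x 0) {0..t}"
    using assms(1) by (auto simp: evolves_def)
  from has_integral_linear[OF this assms(2)]
  show "((\<lambda>t. g (f t)) has_integral g (x t) - g (x 0)) {0..t}"
    by (simp add: o_def bounded_linear.linear linear_diff assms(2))
qed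

lemma evolves_nth:
  "evolves x f \<Longrightarrow> evolves (\<lambda>t. x t $ i) (\<lambda>t. f t $ i)"
  by (rule evolves_linear[OF _ bounded_linear_vec_nth])

lemma evolves_diff:
  assumes "evolves x f" "evolves y g"
  shows "evolves (\<lambda>t. x t - y t) (\<lambda>t. f t - g t)"
  unfolding evolves_def
proof (intro allI impI)
  fix t :: real assume "0 \<le> t"
  then have "((\<lambda>t. f t - g t) has_integral (x t - x 0) - (y t - y 0)) {0..t}"
    using assms by (intro has_integral_diff) (auto simp: evolves_def)
  then show "((\<lambda>t. f t - g t) has_integral x t - y t - (x 0 - y 0)) {0..t}"
    by (simp add: algebra_simps)
qed

lemma evolves_cong:
  assumes "evolves x f" "\<And>t. 0 \<le> t \<Longrightarrow> f t = g t"
  shows "evolves x g"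
  unfolding evolves_def
proof (intro allI impI)
  fix t :: real assume "0 \<le> t"
  then have "(f has_integral x t - x 0) {0..t}"
    using assms(1) by (auto simp: evolves_def)
  then show "(g has_integral x t - x 0) {0..t}"
    by (rule has_integral_eq[rotated]) (use assms(2) in auto)
qed

lemma evolves_lipschitz_on:
  fixes f :: "real \<Rightarrow> 'a::banach"
  assumes "evolves x f" "\<And>t. 0 \<le> t \<Longrightarrow> norm (f t) \<le> C"
  shows "C-lipschitz_on {0..} x"
proof (rule lipschitz_on_leI)
  show "0 \<le> C"
    using assms(2)[of 0] norm_ge_zero[of "f 0"] by linarith
  fix s t :: real assume "s \<in> {0..}" "t \<in> {0..}" "s \<le> t"
  then show "dist (x s) (x t) \<le> C * dist s t"
    using has_integral_bound[of C f "x t - x s" s t] evolves_has_integral[OF assms(1), of s t]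
      assms(2) \<open>0 \<le> C\<close>
    by (auto simp: dist_norm norm_minus_commute cbox_interval)
qed

text \<open>A first-order lag cannot rise above both its initial value and the bound of its input,
  since there its slope is nonpositive. The argument uses integrals because the input
  \<open>q\<close> may be discontinuous.\<close>

lemma evolves_relaxation_bounded:
  fixes p q :: "real \<Rightarrow> real"
  assumes p: "evolves p (\<lambda>t. (q t - p t) / \<tau>)" and "0 < \<tau>"
    and q: "\<And>t. 0 \<le> t \<Longrightarrow> \<bar>q t\<bar> \<le> U"
  obtains C where "\<And>t. 0 \<le> t \<Longrightarrow> \<bar>p t\<bar> \<le> C"
proof -
  have upper: "r t \<le> max U (r 0)"
    if r: "evolves r (\<lambda>t. (d t - r t) / \<tau>)" and d: "\<And>t. 0 \<le> t \<Longrightarrow> d t \<le> U" and "0 \<le> t"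
    for r d :: "real \<Rightarrow> real" and t
  proof (rule nonincreasing_above_imp_bounded[OF evolves_continuous_on[OF r]])
    fix s t :: real
    assume st: "0 \<le> s" "s < t" and above: "\<And>u. s < u \<Longrightarrow> u \<le> t \<Longrightarrow> max U (r 0) < r u"
    have int: "((\<lambda>t. (d t - r t) / \<tau>) has_integral r t - r s) {s..t}"
      using st by (intro evolves_has_integral[OF r]) auto
    have "r t - r s \<le> 0"
    proof (rule has_integral_le)
      \<comment> \<open>At the left end \<open>s\<close> the assumption \<open>above\<close> says
        nothing. The comparison function therefore agrees with the integrand at that single point,
        which does not affect its integral.\<close>
      show "((\<lambda>u. if u = s then (d u - r u) / \<tau> else 0) has_integral 0) {s..t}"
        by (rule has_integral_spike[where S = "{s}" and f = "\<lambda>_. 0"]) auto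
      show "((\<lambda>t. (d t - r t) / \<tau>) has_integral r t - r s) {s..t}"
        by (rule int)
      fix u assume "u \<in> {s..t}"
      then show "(d u - r u) / \<tau> \<le> (if u = s then (d u - r u) / \<tau> else 0)"
        using above[of u] d[of u] st \<open>0 < \<tau>\<close> by (auto simp: divide_nonpos_pos)
    qed
    then show "r t \<le> r s"
      by simp
  qed (use \<open>0 \<le> t\<close> in auto)
  have "p t \<le> max U (p 0)" if "0 \<le> t" for t
    using p q that by (intro upper[of p q]) (auto simp: abs_le_iff)
  moreover have "- p t \<le> max U (- p 0)" if "0 \<le> t" for t
  proof (rule upper[of "\<lambda>t. - p t" "\<lambda>t. - q t"])
    show "evolves (\<lambda>t. - p t) (\<lambda>t. (- q t - - p t) / \<tau>)"
      by (rule evolves_cong[OF evolves_linear[OF p bounded_linear_minus[OF bounded_linear_ident]]])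
        (simp add: minus_divide_left)
  qed (use q that in \<open>auto simp: abs_le_iff\<close>)
  ultimately show ?thesis
    by (intro that[of "max U (p 0) + max U (- p 0) + \<bar>p 0\<bar>"]) fastforce
qed

subsection \<open>Positive definite matrices\<close>

lemma sym_pos_def_inner_commute:
  "sym_pos_def M \<Longrightarrow> u \<bullet> (M *v v) = v \<bullet> (M *v u)"
  by (metis dot_lmul_matrix inner_commute sym_pos_def_def transpose_matrix_vector)

lemma sym_pos_def_nonneg: "sym_pos_def M \<Longrightarrow> 0 \<le> x \<bullet> (M *v x)"
  by (cases "x = 0") (auto simp: sym_pos_def_def less_imp_le)

text \<open>The form attains a positive minimum on the compact unit sphere, and it is homogeneous of
  degree two.\<close>

lemma sym_pos_def_lower_bound:
  fixes M :: "real^'n^'n"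
  assumes "sym_pos_def M"
  obtains l where "0 < l" "\<And>x. l * (norm x)\<^sup>2 \<le> x \<bullet> (M *v x)"
proof -
  have "sphere (0::real^'n) 1 \<noteq> {}"
    by simp
  moreover have "continuous_on (sphere 0 1) (\<lambda>x. x \<bullet> (M *v x))"
    by (intro continuous_intros linear_continuous_on) auto
  ultimately obtain z where z: "z \<in> sphere 0 1" "\<And>x. x \<in> sphere 0 1 \<Longrightarrow> z \<bullet> (M *v z) \<le> x \<bullet> (M *v x)"
    using continuous_attains_inf[of "sphere (0::real^'n) 1" "\<lambda>x. x \<bullet> (M *v x)"] by auto
  show ?thesis
  proof (rule that)
    have "z \<noteq> 0"
      using z by auto
    then show "0 < z \<bullet> (M *v z)"
      using assms by (auto simp: sym_pos_def_def)
    fix x :: "real^'n"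
    show "z \<bullet> (M *v z) * (norm x)\<^sup>2 \<le> x \<bullet> (M *v x)"
    proof (cases "x = 0")
      case False
      then have "z \<bullet> (M *v z) \<le> (x /\<^sub>R norm x) \<bullet> (M *v (x /\<^sub>R norm x))"
        by (intro z) auto
      then show ?thesis
        using False by (simp add: matrix_vector_mult_scaleR field_simps power2_eq_square)
    qed simp
  qed
qed

lemma matrix_vector_bound:
  fixes M :: "real^'n^'m"
  obtains B where "0 < B" "\<And>x. norm (M *v x) \<le> B * norm x"
  using bounded_linear.pos_bounded[OF matrix_vector_mul_bounded_linear[of M]]
  by (metis mult.commute)

text \<open>Supplies the weight for the energy of the parameter errors: weighted by the inverse of
  the adaptation gain, the derivative of that energy no longer contains the gain. Positivity comes
  from \<open>x \<bullet> (R *v x) = (R *v x) \<bullet> (M *v (R *v x))\<close>.\<close>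

lemma sym_pos_def_inverse:
  fixes M :: "real^'n^'n"
  assumes "sym_pos_def M"
  obtains R where "sym_pos_def R" "\<And>x. R *v (M *v x) = x"
proof -
  have "inj ((*v) M)"
  proof (rule linear_injective_0[THEN iffD2])
    show "\<forall>x. M *v x = 0 \<longrightarrow> x = 0"
      using assms by (metis inner_zero_right less_irrefl sym_pos_def_def)
  qed auto
  then obtain R where R: "R ** M = mat 1"
    using matrix_left_invertible_injective by blast
  then have R': "M ** R = mat 1"
    by (simp add: matrix_left_right_inverse)
  have RM: "R *v (M *v x) = x" "M *v (R *v x) = x" for x
    by (simp_all add: matrix_vector_mul_assoc R R')
  have "transpose R = R"
  proof -
    have "transpose R = transpose R ** (M ** R)"
      by (simp add: R')
    also have "\<dots> = transpose (M ** R) ** R"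
      using assms by (simp add: matrix_mul_assoc matrix_transpose_mul sym_pos_def_def)
    finally show ?thesis
      by (simp add: R' transpose_mat)
  qed
  moreover have "0 < x \<bullet> (R *v x)" if "x \<noteq> 0" for x
  proof -
    have "R *v x \<noteq> 0"
      using RM(2)[of x] that by auto
    then have "0 < (R *v x) \<bullet> (M *v (R *v x))"
      using assms by (auto simp: sym_pos_def_def)
    then show ?thesis
      by (simp add: RM inner_commute)
  qed
  ultimately show ?thesis
    using RM by (intro that[of R]) (auto simp: sym_pos_def_def)
qed

lemma lyapunov_form:
  assumes "transpose A ** P + P ** A = - Q" "sym_pos_def P"
  shows "2 * (x \<bullet> (P *v (A *v x))) = - (x \<bullet> (Q *v x))"
proof -
  have "x \<bullet> ((transpose A ** P) *v x) = (P *v x) \<bullet> (A *v x)"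
    by (metis dot_lmul_matrix inner_commute matrix_vector_mul_assoc transpose_matrix_vector)
  also have "\<dots> = x \<bullet> (P *v (A *v x))"
    using sym_pos_def_inner_commute[OF assms(2), of x "A *v x"] by (simp add: inner_commute)
  finally have "x \<bullet> ((transpose A ** P + P ** A) *v x) = 2 * (x \<bullet> (P *v (A *v x)))"
    by (simp add: matrix_vector_mult_add_rdistrib inner_add_right matrix_vector_mul_assoc)
  moreover have "x \<bullet> ((- Q) *v x) = - (x \<bullet> (Q *v x))"
    using matrix_vector_mult_diff_rdistrib[of 0 Q x] by simp
  ultimately show ?thesis
    using assms(1) by simp
qed

lemma quadratic_form_has_derivative:
  assumes "sym_pos_def P" "(y has_vector_derivative y') (at t)"
  shows "((\<lambda>t. y t \<bullet> (P *v y t)) has_real_derivative 2 * (y t \<bullet> (P *v y'))) (at t)"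
proof -
  have "((\<lambda>t. P *v y t) has_vector_derivative P *v y') (at t)"
    by (rule bounded_linear.has_vector_derivative[OF matrix_vector_mul_bounded_linear assms(2)])
  from bounded_bilinear.has_vector_derivative[OF bounded_bilinear_inner assms(2) this]
  show ?thesis
    using sym_pos_def_inner_commute[OF assms(1), of y' "y t"]
    by (simp add: has_real_derivative_iff_has_vector_derivative)
qed

lemma continuous_on_weighted_norm:
  "continuous_on S y \<Longrightarrow> continuous_on S (\<lambda>t. weighted_norm P (y t))"
  unfolding weighted_norm_def
  by (intro continuous_intros bounded_linear.continuous_on[OF matrix_vector_mul_bounded_linear])

lemma weighted_norm_nonneg: "sym_pos_def P \<Longrightarrow> 0 \<le> weighted_norm P x"
  by (simp add: weighted_norm_def sym_pos_def_nonneg)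

lemma weighted_norm_squared: "sym_pos_def P \<Longrightarrow> (weighted_norm P x)\<^sup>2 = x \<bullet> (P *v x)"
  by (simp add: weighted_norm_def sym_pos_def_nonneg)

subsection \<open>The barrier function\<close>

lemma barrier_nonneg: "r < c \<Longrightarrow> 0 \<le> barrier c r"
  by (simp add: barrier_def)

lemma barrier_ge: "0 \<le> r \<Longrightarrow> r < c \<Longrightarrow> r\<^sup>2 / c \<le> barrier c r"
  unfolding barrier_def by (intro divide_left_mono) auto

lemma barrier_le: "r \<le> R \<Longrightarrow> R < c \<Longrightarrow> barrier c r \<le> r\<^sup>2 / (c - R)"
  unfolding barrier_def by (intro divide_left_mono) auto

lemma barrier_sublevel:
  fixes c :: real
  assumes "0 < c"
  obtains R where "R < c" "\<And>r. 0 \<le> r \<Longrightarrow> r < c \<Longrightarrow> barrier c r \<le> K \<Longrightarrow> r \<le> R"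
proof -
  \<comment> \<open>For \<open>r\<close> above \<open>c / 2\<close>, the bound on the barrier gives
    \<open>(c / 2)\<^sup>2 \<le> (\<bar>K\<bar> + 1) * (c - r)\<close>, which is the second entry of
    the maximum.\<close>
  define R where "R = max (c / 2) (c - c\<^sup>2 / (4 * (\<bar>K\<bar> + 1)))"
  have "r \<le> R" if r: "0 \<le> r" "r < c" "barrier c r \<le> K" for r
  proof (cases "r \<le> c / 2")
    case False
    have "(c / 2)\<^sup>2 \<le> r\<^sup>2"
      using False assms by (intro power_mono) auto
    also have "\<dots> \<le> K * (c - r)"
      using r by (simp add: barrier_def field_simps)
    also have "\<dots> \<le> (\<bar>K\<bar> + 1) * (c - r)"
      using r by (intro mult_right_mono) auto
    finally have "c\<^sup>2 / (4 * (\<bar>K\<bar> + 1)) \<le> c - r"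
      by (simp add: field_simps power2_eq_square)
    then show ?thesis
      by (simp add: R_def)
  qed (simp add: R_def)
  moreover have "R < c"
    using assms by (simp add: R_def add_nonneg_pos)
  ultimately show ?thesis
    using that by blast
qed

lemma barrier'_ge:
  assumes "0 \<le> r" "r < c"
  shows "1 / (2 * c) \<le> barrier' c r"
proof -
  have "(c - r)\<^sup>2 \<le> c\<^sup>2"
    using assms by (intro power_mono) auto
  have "1 / (2 * c) = c / (2 * c\<^sup>2)"
    using assms by (simp add: power2_eq_square)
  also have "\<dots> \<le> (2 * c - r) / (2 * (c - r)\<^sup>2)"
    using assms \<open>(c - r)\<^sup>2 \<le> c\<^sup>2\<close> by (intro frac_le) auto
  finally show ?thesis
    by (simp add: barrier'_def)
qed

lemma barrier'_le:
  assumes "0 \<le> r" "r \<le> R" "R < c"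
  shows "barrier' c r \<le> c / (c - R)\<^sup>2"
proof -
  have "(c - R)\<^sup>2 \<le> (c - r)\<^sup>2"
    using assms by (intro power_mono) auto
  then have "(2 * c - r) / (2 * (c - r)\<^sup>2) \<le> (2 * c) / (2 * (c - R)\<^sup>2)"
    using assms by (intro frac_le) auto
  then show ?thesis
    by (simp add: barrier'_def)
qed

text \<open>As a function of \<open>s = r\<^sup>2\<close>, the barrier \<open>s / (c - sqrt s)\<close> is differentiable even at \<open>0\<close>,
  although \<open>sqrt\<close> is not.\<close>

lemma barrier_of_square_has_derivative:
  assumes "0 \<le> w" "sqrt w < c"
  shows "((\<lambda>s. s / (c - sqrt s)) has_real_derivative barrier' c (sqrt w)) (at w)"
proof (cases "w = 0")
  case True
  have "((\<lambda>h. 1 / (c - sqrt h)) \<longlongrightarrow> 1 / (c - sqrt 0)) (at 0)"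
    using assms True by (intro tendsto_intros) auto
  then have "((\<lambda>h. (h / (c - sqrt h) - 0 / (c - sqrt 0)) / h) \<longlongrightarrow> 1 / (c - sqrt 0)) (at 0)"
    by (rule filterlim_cong[THEN iffD1, rotated -1]) (auto simp: eventually_at_filter)
  then show ?thesis
    using True assms by (simp add: DERIV_def barrier'_def power2_eq_square)
next
  case False
  then have "0 < sqrt w"
    using assms by simp
  have "((\<lambda>s. barrier c (sqrt s)) has_real_derivative barrier' c (sqrt w)) (at w)"
    using barrier_has_derivative[OF \<open>0 < sqrt w\<close> assms(2)] assms(1) by simp
  then show ?thesis
    by (rule has_field_derivative_transform_within_open[where S = "{0<..}"])
      (use False assms in \<open>auto simp: barrier_def\<close>)
qed

lemma barrier_weighted_norm_has_derivative:
  assumes P: "sym_pos_def P" and y: "(y has_vector_derivative y') (at t)"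
    and "weighted_norm P (y t) < c"
  shows "((\<lambda>t. barrier c (weighted_norm P (y t))) has_real_derivative
    barrier' c (weighted_norm P (y t)) * (2 * (y t \<bullet> (P *v y')))) (at t)"
proof -
  have "((\<lambda>t. (y t \<bullet> (P *v y t)) / (c - sqrt (y t \<bullet> (P *v y t)))) has_real_derivative
    barrier' c (weighted_norm P (y t)) * (2 * (y t \<bullet> (P *v y')))) (at t)"
    unfolding weighted_norm_def
    by (rule DERIV_chain2[OF barrier_of_square_has_derivative quadratic_form_has_derivative[OF P y]])
      (use assms sym_pos_def_nonneg[OF P] in \<open>auto simp: weighted_norm_def\<close>)
  then show ?thesis
    by (simp add: barrier_def weighted_norm_squared[OF P] weighted_norm_def[symmetric])
qed

subsection \<open>Errors confined by the barrier\<close>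

text \<open>\<open>E\<close> is the quadratic energy of the parameter errors. Its derivative along the adaptive law
  cancels the contribution of the unknown input \<open>\<eta>\<close> to the derivative of the barrier.\<close>

locale barrier_tracking =
  fixes c :: real and A P Q :: "real^'n^'n" and b :: "real^'n"
    and y :: "real \<Rightarrow> real^'n" and \<eta> E :: "real \<Rightarrow> real"
  assumes c_pos: "0 < c"
    and P: "sym_pos_def P" and Q: "sym_pos_def Q"
    and lyapunov: "transpose A ** P + P ** A = - Q"
    and y_continuous: "continuous_on {0..} y"
    and y_derivative: "\<And>t. 0 < t \<Longrightarrow> (y has_vector_derivative A *v y t + \<eta> t *\<^sub>R b) (at t)"
    and E_continuous: "continuous_on {0..} E"
    and E_nonneg: "\<And>t. 0 \<le> t \<Longrightarrow> 0 \<le> E t"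
    and E_derivative: "\<And>t. 0 < t \<Longrightarrow> weighted_norm P (y t) < c \<Longrightarrow>
      (E has_real_derivative - 2 * barrier' c (weighted_norm P (y t)) * (y t \<bullet> (P *v b)) * \<eta> t) (at t)"
    and initial: "weighted_norm P (y 0) < c"
begin

abbreviation r :: "real \<Rightarrow> real" where
  "r t \<equiv> weighted_norm P (y t)"

definition V :: "real \<Rightarrow> real" where
  "V t = barrier c (r t) + E t"

lemma barrier_derivative:
  assumes "0 < t" "r t < c"
  shows "((\<lambda>t. barrier c (r t)) has_real_derivative
    barrier' c (r t) * (2 * \<eta> t * (y t \<bullet> (P *v b)) - y t \<bullet> (Q *v y t))) (at t)"
proof -
  have "2 * (y t \<bullet> (P *v (A *v y t + \<eta> t *\<^sub>R b))) = 2 * \<eta> t * (y t \<bullet> (P *v b)) - y t \<bullet> (Q *v y t)"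
    using lyapunov_form[OF lyapunov P, of "y t"]
    by (simp add: matrix_vector_right_distrib matrix_vector_mult_scaleR inner_add_right)
  then show ?thesis
    using barrier_weighted_norm_has_derivative[OF P y_derivative[OF assms(1)] assms(2)] by simp
qed

lemma V_derivative:
  assumes "0 < t" "r t < c"
  shows "(V has_real_derivative - (barrier' c (r t) * (y t \<bullet> (Q *v y t)))) (at t)"
  unfolding V_def
  by (rule DERIV_cong[OF DERIV_add[OF barrier_derivative[OF assms] E_derivative[OF assms]]])
    (simp add: algebra_simps)

lemma r_continuous: "continuous_on {0..} r"
  by (rule continuous_on_weighted_norm[OF y_continuous])

lemma V_le_initial:
  assumes "0 \<le> T" "\<And>t. 0 \<le> t \<Longrightarrow> t \<le> T \<Longrightarrow> r t < c"
  shows "V T \<le> V 0"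
proof (cases "T = 0")
  case False
  show ?thesis
  proof (rule DERIV_nonpos_imp_decreasing_open[OF assms(1)])
    fix t assume t: "0 < t" "t < T"
    have "1 / (2 * c) \<le> barrier' c (r t)"
      using assms(2)[of t] t weighted_norm_nonneg[OF P] by (intro barrier'_ge) auto
    then have "0 \<le> barrier' c (r t)"
      using c_pos by (meson divide_nonneg_pos less_imp_le mult_pos_pos order_trans zero_le_one zero_less_numeral)
    then show "\<exists>v. (V has_real_derivative v) (at t) \<and> v \<le> 0"
      using V_derivative[of t] assms(2)[of t] t sym_pos_def_nonneg[OF Q, of "y t"] by force
  next
    have "continuous_on {0..T} r" "continuous_on {0..T} E"
      by (auto intro: continuous_on_subset[OF r_continuous] continuous_on_subset[OF E_continuous])
    moreover have "c - r t \<noteq> 0" if "t \<in> {0..T}" for t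
      using assms(2)[of t] that by auto
    ultimately show "continuous_on {0..T} V"
      unfolding V_def barrier_def by (auto intro!: continuous_intros)
  qed
qed simp

text \<open>Closes the circle left open by \<open>V_le_initial\<close>, where \<open>V\<close>
  decreases only as long as \<open>r < c\<close>: the initial value of \<open>V\<close> bounds the
  barrier, which keeps \<open>r\<close> a fixed distance below \<open>c\<close>, so
  \<open>gap_imp_bounded\<close> applies.\<close>

lemma r_bounded:
  obtains R where "R < c" "\<And>t. 0 \<le> t \<Longrightarrow> r t \<le> R"
proof -
  obtain R where R: "R < c" "\<And>r. 0 \<le> r \<Longrightarrow> r < c \<Longrightarrow> barrier c r \<le> V 0 \<Longrightarrow> r \<le> R"
    using barrier_sublevel[OF c_pos] by metis
  have "r t \<le> R" if "0 \<le> t" for t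
  proof (rule gap_imp_bounded[OF r_continuous R(1) initial _ that])
    fix T assume T: "0 \<le> T" "\<And>t. 0 \<le> t \<Longrightarrow> t \<le> T \<Longrightarrow> r t < c"
    then have "barrier c (r T) \<le> V 0"
      using V_le_initial[OF T] E_nonneg[of T] by (simp add: V_def)
    then show "r T \<le> R"
      using T(2)[of T] T(1) weighted_norm_nonneg[OF P] by (intro R) auto
  qed
  then show ?thesis
    using R(1) that by blast
qed

lemma r_less: "0 \<le> t \<Longrightarrow> r t < c"
  using r_bounded by (metis le_less_trans)

lemma E_le_initial: "0 \<le> t \<Longrightarrow> E t \<le> V 0"
  using V_le_initial[of t] r_less barrier_nonneg[of "r t" c] by (simp add: V_def)

lemma y_bounded:
  obtains Y where "\<And>t. 0 \<le> t \<Longrightarrow> norm (y t) \<le> Y"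
proof -
  obtain l where l: "0 < l" "\<And>x. l * (norm x)\<^sup>2 \<le> x \<bullet> (P *v x)"
    using sym_pos_def_lower_bound[OF P] by blast
  have "norm (y t) \<le> sqrt (c\<^sup>2 / l)" if "0 \<le> t" for t
  proof (rule real_le_rsqrt)
    have "l * (norm (y t))\<^sup>2 \<le> (r t)\<^sup>2"
      using l(2) by (simp add: weighted_norm_squared[OF P])
    also have "\<dots> \<le> c\<^sup>2"
      using r_less[OF that] weighted_norm_nonneg[OF P] by (intro power_mono) auto
    finally show "(norm (y t))\<^sup>2 \<le> c\<^sup>2 / l"
      using l(1) by (simp add: field_simps)
  qed
  then show ?thesis
    by (rule that)
qed

end

subsection \<open>Convergence under adaptation\<close>

lemma bigo_inner:
  fixes x z :: "real \<Rightarrow> 'a::real_inner" and f g :: "real \<Rightarrow> real"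
  assumes "(\<lambda>t. norm (x t)) \<in> O[F](f)" "(\<lambda>t. norm (z t)) \<in> O[F](g)"
  shows "(\<lambda>t. x t \<bullet> z t) \<in> O[F](\<lambda>t. f t * g t)"
proof -
  have "(\<lambda>t. x t \<bullet> z t) \<in> O[F](\<lambda>t. norm (x t) * norm (z t))"
    by (rule bigoI[of _ 1]) (simp add: Cauchy_Schwarz_ineq2)
  then show ?thesis
    using landau_o.big.mult[OF assms] by (rule landau_o.big_trans)
qed

lemma bigo_norm_matrix_vector:
  fixes M :: "real^'n^'m" and f :: "real \<Rightarrow> real"
  assumes "(\<lambda>t. norm (x t)) \<in> O[F](f)"
  shows "(\<lambda>t. norm (M *v x t)) \<in> O[F](f)"
proof -
  obtain B where "\<And>v. norm (M *v v) \<le> B * norm v"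
    using matrix_vector_bound[of M] by blast
  then have "(\<lambda>t. norm (M *v x t)) \<in> O[F](\<lambda>t. norm (x t))"
    by (intro bigoI[of _ B]) auto
  then show ?thesis
    using assms by (rule landau_o.big_trans)
qed

lemma bigo_norm_add:
  fixes x z :: "real \<Rightarrow> 'a::real_normed_vector" and f :: "real \<Rightarrow> real"
  assumes "(\<lambda>t. norm (x t)) \<in> O[F](f)" "(\<lambda>t. norm (z t)) \<in> O[F](f)"
  shows "(\<lambda>t. norm (x t + z t)) \<in> O[F](f)"
proof -
  have "(\<lambda>t. norm (x t + z t)) \<in> O[F](\<lambda>t. norm (x t) + norm (z t))"
    by (rule bigoI[of _ 1]) (simp add: norm_triangle_ineq)
  then show ?thesis
    using sum_in_bigo(1)[OF assms] by (rule landau_o.big_trans)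
qed

text \<open>Over a principal filter, big-O means a bound with one constant on the whole set. The
  Landau calculus thus tracks uniform bounds for all positive times without naming their
  constants.\<close>

lemma bigo_principalE:
  fixes f g :: "real \<Rightarrow> real"
  assumes "f \<in> O[principal S](g)"
  obtains C where "\<And>t. t \<in> S \<Longrightarrow> \<bar>f t\<bar> \<le> C * \<bar>g t\<bar>"
proof -
  obtain C where "\<forall>t\<in>S. norm (f t) \<le> C * norm (g t)"
    using landau_o.bigE[OF assms] by (auto simp: eventually_principal)
  then show ?thesis
    by (intro that[of C]) auto
qed

text \<open>Here \<open>k\<close> is the parameter error, that is the adaptive gain minus its ideal
  value, and \<open>\<phi>\<close> is the regressor. The derivative of \<open>k\<close> is only
  assumed while \<open>weighted_norm P (y t) < c\<close>, because \<open>barrier'\<close> is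
  singular at \<open>c\<close>.\<close>

locale adaptive_tracking =
  fixes c :: real and A P Q :: "real^'n^'n" and b :: "real^'n"
    and y :: "real \<Rightarrow> real^'n"
    and G :: "real^'n^'n" and k \<phi> :: "real \<Rightarrow> real^'n" and \<theta> :: real
  assumes c_pos: "0 < c"
    and P: "sym_pos_def P" and Q: "sym_pos_def Q"
    and lyapunov: "transpose A ** P + P ** A = - Q"
    and G: "sym_pos_def G" and \<theta>_pos: "0 < \<theta>" and b_nonzero: "b \<noteq> 0"
    and y_continuous: "continuous_on {0..} y"
    and y_derivative: "\<And>t. 0 < t \<Longrightarrow>
      (y has_vector_derivative A *v y t + (\<theta> * (k t \<bullet> \<phi> t)) *\<^sub>R b) (at t)"
    and k_continuous: "continuous_on {0..} k"
    and k_derivative: "\<And>t. 0 < t \<Longrightarrow> weighted_norm P (y t) < c \<Longrightarrow>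
      (k has_vector_derivative adaptation c G P b (\<phi> t) (y t)) (at t)"
    and initial: "weighted_norm P (y 0) < c"
begin

definition R :: "real^'n^'n" where
  "R = (SOME R. sym_pos_def R \<and> (\<forall>x. R *v (G *v x) = x))"

lemma R: "sym_pos_def R" "R *v (G *v x) = x"
proof -
  have "\<exists>R. sym_pos_def R \<and> (\<forall>x. R *v (G *v x) = x)"
    using sym_pos_def_inverse[OF G] by metis
  then have "sym_pos_def R \<and> (\<forall>x. R *v (G *v x) = x)"
    unfolding R_def by (rule someI_ex)
  then show "sym_pos_def R" "R *v (G *v x) = x"
    by auto
qed

text \<open>The weight \<open>R\<close> removes the gain from the adaptive law, and the factor
  \<open>\<theta>\<close> matches the unknown effectiveness of the input, so the derivative of this
  energy is exactly the cancelling term.\<close>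

sublocale barrier_tracking c A P Q b y "\<lambda>t. \<theta> * (k t \<bullet> \<phi> t)" "\<lambda>t. \<theta> * (k t \<bullet> (R *v k t))"
proof
  show "continuous_on {0..} (\<lambda>t. \<theta> * (k t \<bullet> (R *v k t)))"
    by (intro continuous_intros bounded_linear.continuous_on[OF matrix_vector_mul_bounded_linear] k_continuous)
  show "0 \<le> \<theta> * (k t \<bullet> (R *v k t))" for t
    using \<theta>_pos sym_pos_def_nonneg[OF R(1)] by simp
  fix t assume "0 < t" "weighted_norm P (y t) < c"
  note quadratic_form_has_derivative[OF R(1) k_derivative[OF this]]
  from DERIV_cmult[OF this, of \<theta>]
  show "((\<lambda>t. \<theta> * (k t \<bullet> (R *v k t))) has_real_derivative
    - 2 * barrier' c (weighted_norm P (y t)) * (y t \<bullet> (P *v b)) * (\<theta> * (k t \<bullet> \<phi> t))) (at t)"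
    by (rule DERIV_cong)
      (simp add: adaptation_def R(2) matrix_vector_mult_scaleR linear_neg[OF matrix_vector_mul_linear])
qed (use c_pos P Q lyapunov y_continuous y_derivative initial in auto)

lemma k_bounded:
  obtains K where "\<And>t. 0 \<le> t \<Longrightarrow> norm (k t) \<le> K"
proof -
  obtain l where l: "0 < l" "\<And>x. l * (norm x)\<^sup>2 \<le> x \<bullet> (R *v x)"
    using sym_pos_def_lower_bound[OF R(1)] by blast
  have "norm (k t) \<le> sqrt (V 0 / \<theta> / l)" if "0 \<le> t" for t
  proof (rule real_le_rsqrt)
    have "\<theta> * (l * (norm (k t))\<^sup>2) \<le> \<theta> * (k t \<bullet> (R *v k t))"
      using l(2) \<theta>_pos by (intro mult_left_mono) auto
    also have "\<dots> \<le> V 0"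
      by (rule E_le_initial[OF that])
    finally show "(norm (k t))\<^sup>2 \<le> V 0 / \<theta> / l"
      using l(1) \<theta>_pos by (simp add: field_simps)
  qed
  then show ?thesis
    by (rule that)
qed

text \<open>The regressor \<open>\<phi>\<close> may be unbounded, so Barbalat's lemma does not apply to \<open>y\<close> directly.
  A large regressor makes \<open>y\<close> and \<open>k \<bullet> \<phi>\<close> oscillate fast, but the oscillator energy \<open>J\<close> varies
  slowly. By the virial function \<open>F\<close>, the potential part of \<open>J\<close> has the same
  time average as the kinetic part, up to errors of order \<open>norm y\<close>.\<close>

lemma tracking:
  fixes p :: "real \<Rightarrow> real^'n" and d :: "real^'n"
  assumes \<phi>_derivative: "\<And>t. 0 < t \<Longrightarrow>
      (\<phi> has_vector_derivative p t + (\<theta> * (k t \<bullet> \<phi> t)) *\<^sub>R d) (at t)"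
    and p_bounded: "\<And>t. 0 < t \<Longrightarrow> norm (p t) \<le> D"
  shows "(y \<longlongrightarrow> 0) at_top"
proof -
  define \<beta> where "\<beta> = b \<bullet> (P *v b)"
  have "0 < \<beta>"
    using P b_nonzero by (auto simp: \<beta>_def sym_pos_def_def)
  define \<sigma> where "\<sigma> t = barrier' c (r t)" for t
  define s where "s t = y t \<bullet> (P *v b)" for t
  define \<mu> where "\<mu> t = \<phi> t \<bullet> (G *v \<phi> t)" for t
  have \<mu>: "0 \<le> \<mu> t" for t
    using sym_pos_def_nonneg[OF G] by (simp add: \<mu>_def)
  \<comment> \<open>\<open>m\<close> measures the size of the regressor and normalizes it to the
    bounded \<open>\<psi>\<close>. Then \<open>k \<bullet> \<phi> = m * h\<close>, its derivative is
    \<open>m * e - \<sigma> * s * \<mu>\<close>, and that of \<open>\<mu>\<close> is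
    \<open>m\<^sup>2 * \<rho>\<close>, where \<open>h\<close>, \<open>e\<close> and
    \<open>\<rho>\<close> are bounded although \<open>\<phi>\<close> need not be.\<close>
  define m where "m t = sqrt (1 + \<mu> t)" for t
  have m: "1 \<le> m t" "0 < m t" "m t \<noteq> 0" "(m t)\<^sup>2 = 1 + \<mu> t" for t
    using \<mu>[of t] by (auto simp: m_def intro: less_le_trans)
  define \<psi> where "\<psi> t = (1 / m t) *\<^sub>R \<phi> t" for t
  define h where "h t = k t \<bullet> \<psi> t" for t
  define e where "e t = (k t \<bullet> p t) * (1 / m t) + \<theta> * h t * (k t \<bullet> d)" for t
  define \<rho> where "\<rho> t = 2 * (\<psi> t \<bullet> (G *v ((1 / m t) *\<^sub>R p t + (\<theta> * h t) *\<^sub>R d)))" for t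

  let ?P = "principal {0<..} :: real filter"
  let ?n = "\<lambda>t. norm (y t)"
  have bounded: "f \<in> O[?P](\<lambda>_. 1)" if "\<And>t. 0 < t \<Longrightarrow> \<bar>f t\<bar> \<le> C" for f :: "real \<Rightarrow> real" and C
    using that by (intro bigoI[of _ C]) (auto simp: eventually_principal)
  have product: "(\<lambda>t. f t * g t) \<in> O[?P](\<lambda>_. 1)"
    if "f \<in> O[?P](\<lambda>_. 1)" "g \<in> O[?P](\<lambda>_. 1)" for f g :: "real \<Rightarrow> real"
    using landau_o.big_1_mult[OF that] .
  have inner: "(\<lambda>t. x t \<bullet> z t) \<in> O[?P](\<lambda>_. 1)"
    if "(\<lambda>t. norm (x t)) \<in> O[?P](\<lambda>_. 1)" "(\<lambda>t. norm (z t)) \<in> O[?P](\<lambda>_. 1)"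
    for x z :: "real \<Rightarrow> real^'i"
    using bigo_inner[OF that] by simp
  have scaleR: "(\<lambda>t. norm (f t *\<^sub>R x t)) \<in> O[?P](\<lambda>_. 1)"
    if "f \<in> O[?P](\<lambda>_. 1)" "(\<lambda>t. norm (x t)) \<in> O[?P](\<lambda>_. 1)" for f and x :: "real \<Rightarrow> real^'i"
    using landau_o.big_1_mult[OF that[THEN landau_o.big.abs_in_iff[THEN iffD2]]] by simp
  note bounded_intros = sum_in_bigo product inner scaleR bigo_norm_add bigo_norm_matrix_vector bigo_const

  obtain R where R: "R < c" "\<And>t. 0 \<le> t \<Longrightarrow> r t \<le> R"
    using r_bounded by blast
  have r_pos: "0 \<le> r t" for t
    by (rule weighted_norm_nonneg[OF P])
  obtain Y where Y: "\<And>t. 0 \<le> t \<Longrightarrow> norm (y t) \<le> Y"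
    using y_bounded by blast
  obtain K where K: "\<And>t. 0 \<le> t \<Longrightarrow> norm (k t) \<le> K"
    using k_bounded by blast
  have \<sigma>_pos: "1 / (2 * c) \<le> \<sigma> t" if "0 \<le> t" for t
    unfolding \<sigma>_def using that r_pos r_less by (intro barrier'_ge)
  have y_O: "?n \<in> O[?P](\<lambda>_. 1)"
    by (rule bounded[of _ Y]) (use Y in auto)
  have k_O: "(\<lambda>t. norm (k t)) \<in> O[?P](\<lambda>_. 1)"
    by (rule bounded[of _ K]) (use K in auto)
  have p_O: "(\<lambda>t. norm (p t)) \<in> O[?P](\<lambda>_. 1)"
    by (rule bounded[of _ D]) (use p_bounded in auto)
  have m_O: "(\<lambda>t. 1 / m t) \<in> O[?P](\<lambda>_. 1)"
    by (rule bounded[of _ 1]) (use m(1,2) in \<open>simp add: abs_of_pos\<close>)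
  have \<sigma>_O: "\<sigma> \<in> O[?P](\<lambda>_. 1)"
  proof (rule bounded[of _ "c / (c - R)\<^sup>2"])
    fix t :: real assume "0 < t"
    have "0 < 1 / (2 * c)"
      using c_pos by simp
    also have "\<dots> \<le> \<sigma> t"
      using \<sigma>_pos \<open>0 < t\<close> by simp
    finally show "\<bar>\<sigma> t\<bar> \<le> c / (c - R)\<^sup>2"
      unfolding \<sigma>_def using barrier'_le[OF r_pos R(2) R(1), of t] \<open>0 < t\<close> by simp
  qed
  have \<psi>_O: "(\<lambda>t. norm (\<psi> t)) \<in> O[?P](\<lambda>_. 1)"
  proof -
    obtain l where l: "0 < l" "\<And>x. l * (norm x)\<^sup>2 \<le> x \<bullet> (G *v x)"
      using sym_pos_def_lower_bound[OF G] by blast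
    have "norm (\<psi> t) \<le> sqrt (1 / l)" for t
    proof (rule real_le_rsqrt)
      have "l * (norm (\<phi> t))\<^sup>2 \<le> (m t)\<^sup>2"
        using l(2)[of "\<phi> t"] by (simp add: m \<mu>_def)
      then show "(norm (\<psi> t))\<^sup>2 \<le> 1 / l"
        using l(1) m(2)[of t] by (simp add: \<psi>_def field_simps)
    qed
    then show ?thesis
      by (intro bounded[of _ "sqrt (1 / l)"]) simp
  qed
  have h_O: "h \<in> O[?P](\<lambda>_. 1)"
    unfolding h_def by (intro bounded_intros k_O \<psi>_O)
  have e_O: "e \<in> O[?P](\<lambda>_. 1)"
    unfolding e_def by (intro bounded_intros k_O p_O m_O h_O)
  have \<rho>_O: "\<rho> \<in> O[?P](\<lambda>_. 1)"
    unfolding \<rho>_def by (intro bounded_intros p_O m_O h_O \<psi>_O)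
  have s_O_y: "s \<in> O[?P](?n)"
    unfolding s_def using bigo_inner[of y ?P ?n "\<lambda>_. P *v b" "\<lambda>_. 1"] by simp
  have s_O: "s \<in> O[?P](\<lambda>_. 1)"
    using s_O_y y_O by (rule landau_o.big_trans)

  define J where "J t = barrier c (r t) + \<theta> * (k t \<bullet> \<phi> t)\<^sup>2 / (1 + \<mu> t)" for t
  define F where "F t = s t * (k t \<bullet> \<phi> t) / (1 + \<mu> t)" for t
  \<comment> \<open>The barrier contributes \<open>2 * \<theta> * \<sigma> * s * h * m\<close>,
    which may grow with the regressor. Adaptation of \<open>k\<close> in the second part of
    \<open>J\<close> contributes the same term with \<open>- (m - 1 / m)\<close> in place of
    \<open>m\<close>, so only \<open>1 / m\<close> survives.\<close>
  define J' where "J' t = - (\<sigma> t * (y t \<bullet> (Q *v y t)))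
    + \<theta> * (2 * \<sigma> t * s t * h t * (1 / m t) + 2 * h t * e t - h t * h t * \<rho> t)" for t
  \<comment> \<open>The derivative of \<open>F\<close> without its leading term
    \<open>\<theta> * \<beta> * h\<^sup>2\<close>, which arises when the input
    \<open>\<theta> * m * h\<close> drives \<open>s\<close>. Every summand has a factor
    \<open>A *v y\<close> or \<open>s\<close>, hence is of order \<open>norm y\<close>.\<close>
  define F\<^sub>1 where "F\<^sub>1 t = ((A *v y t) \<bullet> (P *v b)) * (h t * (1 / m t))
    + s t * (\<sigma> t * ((1 / m t) * (1 / m t) - 1) * s t + e t * (1 / m t) - h t * (1 / m t) * \<rho> t)" for t

  have \<eta>: "k t \<bullet> \<phi> t = m t * h t" for t
    by (simp add: h_def \<psi>_def m)
  have \<eta>_derivative: "((\<lambda>t. k t \<bullet> \<phi> t) has_real_derivative m t * e t - \<sigma> t * s t * \<mu> t) (at t)"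
    if "0 < t" for t
  proof -
    have "((\<lambda>t. k t \<bullet> \<phi> t) has_vector_derivative
      k t \<bullet> (p t + (\<theta> * (k t \<bullet> \<phi> t)) *\<^sub>R d) + adaptation c G P b (\<phi> t) (y t) \<bullet> \<phi> t) (at t)"
      using that r_less[of t]
      by (intro bounded_bilinear.has_vector_derivative[OF bounded_bilinear_inner] k_derivative \<phi>_derivative) auto
    moreover have "k t \<bullet> (p t + (\<theta> * (k t \<bullet> \<phi> t)) *\<^sub>R d) = m t * e t"
      using m(3)[of t] by (simp add: \<eta> e_def inner_add_right algebra_simps)
    moreover have "adaptation c G P b (\<phi> t) (y t) \<bullet> \<phi> t = - (\<sigma> t * s t * \<mu> t)"
      by (simp add: adaptation_def \<sigma>_def s_def \<mu>_def inner_commute)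
    ultimately show ?thesis
      by (simp add: has_real_derivative_iff_has_vector_derivative)
  qed
  have \<mu>_derivative: "(\<mu> has_real_derivative (m t)\<^sup>2 * \<rho> t) (at t)" if "0 < t" for t
  proof -
    have "\<phi> t = m t *\<^sub>R \<psi> t" "p t + (\<theta> * (k t \<bullet> \<phi> t)) *\<^sub>R d = m t *\<^sub>R ((1 / m t) *\<^sub>R p t + (\<theta> * h t) *\<^sub>R d)"
      using m(3)[of t] by (simp_all add: \<psi>_def \<eta> scaleR_add_right)
    then have "2 * (\<phi> t \<bullet> (G *v (p t + (\<theta> * (k t \<bullet> \<phi> t)) *\<^sub>R d))) = (m t)\<^sup>2 * \<rho> t"
      by (simp add: \<rho>_def matrix_vector_mult_scaleR power2_eq_square)
    then show ?thesis
      using quadratic_form_has_derivative[OF G \<phi>_derivative[OF that]] by (simp add: \<mu>_def[abs_def])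
  qed
  have s_derivative: "(s has_real_derivative (A *v y t) \<bullet> (P *v b) + \<theta> * (m t * h t) * \<beta>) (at t)"
    if "0 < t" for t
  proof -
    have "(s has_vector_derivative (A *v y t + (\<theta> * (k t \<bullet> \<phi> t)) *\<^sub>R b) \<bullet> (P *v b)) (at t)"
      unfolding s_def
      by (rule bounded_linear.has_vector_derivative[OF bounded_linear_inner_left y_derivative[OF that]])
    then show ?thesis
      by (simp add: has_real_derivative_iff_has_vector_derivative inner_add_left \<eta> \<beta>_def)
  qed
  have \<mu>_m: "1 + \<mu> t \<noteq> 0" "\<mu> t = (m t)\<^sup>2 - 1" for t
    using \<mu>[of t] m(4)[of t] by auto

  have J_derivative: "(J has_real_derivative J' t) (at t)" if "0 < t" for t
  proof -
    have "(J has_real_derivative barrier' c (r t) *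
        (2 * (\<theta> * (k t \<bullet> \<phi> t)) * (y t \<bullet> (P *v b)) - y t \<bullet> (Q *v y t))
      + (\<theta> * (real 2 * ((m t * e t - \<sigma> t * s t * \<mu> t) * (k t \<bullet> \<phi> t) ^ (2 - Suc 0))) * (1 + \<mu> t)
        - \<theta> * (k t \<bullet> \<phi> t)\<^sup>2 * (0 + (m t)\<^sup>2 * \<rho> t)) / ((1 + \<mu> t) * (1 + \<mu> t))) (at t)"
      unfolding J_def using that r_less[of t] \<mu>_m(1)
      by (intro DERIV_add barrier_derivative DERIV_divide DERIV_cmult DERIV_power \<eta>_derivative
          \<mu>_derivative DERIV_const) auto
    then show ?thesis
      by (rule DERIV_cong) (use m(3)[of t] in \<open>simp add: \<eta> J'_def \<sigma>_def s_def \<mu>_m field_simps power2_eq_square\<close>)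
  qed
  have F_derivative: "(F has_real_derivative \<theta> * \<beta> * (h t)\<^sup>2 + F\<^sub>1 t) (at t)" if "0 < t" for t
  proof -
    have "(F has_real_derivative
      ((((A *v y t) \<bullet> (P *v b) + \<theta> * (m t * h t) * \<beta>) * (k t \<bullet> \<phi> t)
        + (m t * e t - \<sigma> t * s t * \<mu> t) * s t) * (1 + \<mu> t)
        - s t * (k t \<bullet> \<phi> t) * (0 + (m t)\<^sup>2 * \<rho> t)) / ((1 + \<mu> t) * (1 + \<mu> t))) (at t)"
      unfolding F_def using that \<mu>_m(1)
      by (intro DERIV_add DERIV_divide DERIV_mult s_derivative \<eta>_derivative \<mu>_derivative DERIV_const)
    then show ?thesis
      by (rule DERIV_cong) (use m(3)[of t] in \<open>simp add: \<eta> F\<^sub>1_def \<mu>_m field_simps power2_eq_square\<close>)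
  qed

  have "J' \<in> O[?P](\<lambda>_. 1)"
    unfolding J'_def landau_o.big.uminus_in_iff
    by (intro sum_in_bigo landau_o.big.uminus_in_iff[THEN iffD2] bounded_intros y_O \<sigma>_O s_O h_O m_O e_O \<rho>_O)
  then obtain C\<^sub>1 where C\<^sub>1: "\<And>t. 0 < t \<Longrightarrow> \<bar>J' t\<bar> \<le> C\<^sub>1"
    by (rule bigo_principalE) auto
  have F_eq: "F t = s t * (h t * (1 / m t))" for t
    using m(3)[of t] by (simp add: F_def \<eta> \<mu>_m power2_eq_square)
  have "F \<in> O[?P](?n)"
    unfolding F_eq[abs_def] by (intro landau_o.big_1_mult s_O_y bounded_intros h_O m_O)
  then obtain C\<^sub>2 where C\<^sub>2: "\<And>t. 0 < t \<Longrightarrow> \<bar>F t\<bar> \<le> C\<^sub>2 * ?n t"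
    by (rule bigo_principalE) auto
  \<comment> \<open>As \<open>r\<close> stays below \<open>R < c\<close>, the barrier is at most a
    multiple of a quadratic form in \<open>y\<close>, and one of its two factors \<open>y\<close> is
    bounded.\<close>
  have barrier_O: "(\<lambda>t. barrier c (r t)) \<in> O[?P](?n)"
  proof -
    have "(\<lambda>t. barrier c (r t)) \<in> O[?P](\<lambda>t. y t \<bullet> (P *v y t))"
    proof (rule bigoI[of _ "1 / (c - R)"], unfold eventually_principal, intro ballI)
      fix t :: real assume "t \<in> {0<..}"
      then show "norm (barrier c (r t)) \<le> 1 / (c - R) * norm (y t \<bullet> (P *v y t))"
        using barrier_le[of "r t" R c] R barrier_nonneg[of "r t" c] r_less[of t]
          sym_pos_def_nonneg[OF P, of "y t"]
        by (simp add: weighted_norm_squared[OF P])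
    qed
    also have "(\<lambda>t. y t \<bullet> (P *v y t)) \<in> O[?P](\<lambda>t. ?n t * 1)"
      by (intro bigo_inner bigo_norm_matrix_vector y_O) simp
    finally show ?thesis
      by simp
  qed
  have "(\<lambda>t. F\<^sub>1 t - \<beta> * barrier c (r t)) \<in> O[?P](?n)"
  proof (intro sum_in_bigo)
    show "F\<^sub>1 \<in> O[?P](?n)"
      unfolding F\<^sub>1_def
    proof (intro sum_in_bigo landau_o.big_1_mult s_O_y)
      have "(\<lambda>t. (A *v y t) \<bullet> (P *v b)) \<in> O[?P](\<lambda>t. ?n t * 1)"
        by (intro bigo_inner bigo_norm_matrix_vector bigo_const) simp
      then show "(\<lambda>t. (A *v y t) \<bullet> (P *v b)) \<in> O[?P](?n)"
        by simp
    qed (intro bounded_intros \<sigma>_O s_O h_O m_O e_O \<rho>_O)+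
    show "(\<lambda>t. \<beta> * barrier c (r t)) \<in> O[?P](?n)"
      using barrier_O by simp
  qed
  then obtain C\<^sub>3 where C\<^sub>3: "\<And>t. 0 < t \<Longrightarrow> \<bar>F\<^sub>1 t - \<beta> * barrier c (r t)\<bar> \<le> C\<^sub>3 * ?n t"
    by (rule bigo_principalE) auto
  define C where "C = max C\<^sub>1 (max C\<^sub>2 C\<^sub>3)"
  have C: "C\<^sub>1 \<le> C" "C\<^sub>2 * ?n t \<le> C * ?n t" "C\<^sub>3 * ?n t \<le> C * ?n t" for t
    by (auto simp: C_def intro!: mult_right_mono)
  obtain q where q: "0 < q" "\<And>x. q * (norm x)\<^sup>2 \<le> x \<bullet> (Q *v x)"
    using sym_pos_def_lower_bound[OF Q] by blast
  have J_nonneg: "barrier c (r t) \<le> J t" for t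
    using \<theta>_pos \<mu>[of t] by (simp add: J_def)
  have "(J \<longlongrightarrow> 0) at_top"
  proof (rule virial_tendsto_zero)
    fix t :: real assume t: "0 < t"
    show "(V has_real_derivative - (\<sigma> t * (y t \<bullet> (Q *v y t)))) (at t)"
      unfolding \<sigma>_def using t r_less[of t] by (intro V_derivative) auto
    show "(F has_real_derivative \<theta> * \<beta> * (h t)\<^sup>2 + F\<^sub>1 t) (at t)" "(J has_real_derivative J' t) (at t)"
      using t by (auto intro: F_derivative J_derivative)
    show "0 \<le> V t"
      using E_nonneg[of t] barrier_nonneg[of "r t" c] r_less[of t] t by (simp add: V_def)
    show "0 \<le> J t"
      using J_nonneg[of t] barrier_nonneg[of "r t" c] r_less[of t] t by simp
    have "1 / (2 * c) * (q * (?n t)\<^sup>2) \<le> \<sigma> t * (y t \<bullet> (Q *v y t))"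
      using \<sigma>_pos[of t] t q c_pos by (intro mult_mono) (auto intro: order_trans[OF _ \<sigma>_pos])
    then show "- (\<sigma> t * (y t \<bullet> (Q *v y t))) \<le> - (q / (2 * c)) * (?n t)\<^sup>2"
      by simp
    show "\<bar>J' t\<bar> \<le> C" "\<bar>F t\<bar> \<le> C * ?n t"
      using C\<^sub>1[OF t] C\<^sub>2[OF t] C(1) C(2)[of t] by linarith+
    \<comment> \<open>The leading term of the derivative of \<open>F\<close> is therefore
      \<open>\<beta> * J\<close> minus \<open>\<beta>\<close> times the barrier. The latter is of
      order \<open>norm y\<close> and was included in \<open>C\<^sub>3\<close>.\<close>
    have "J t = barrier c (r t) + \<theta> * (h t)\<^sup>2"
      using m(3)[of t] by (simp add: J_def \<eta> \<mu>_m power2_eq_square)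
    then show "\<beta> * J t - C * ?n t \<le> \<theta> * \<beta> * (h t)\<^sup>2 + F\<^sub>1 t"
      using C\<^sub>3[OF t] C(3)[of t] by (simp add: algebra_simps abs_le_iff)
  qed (use q c_pos \<open>0 < \<beta>\<close> in auto)
  obtain l where l: "0 < l" "\<And>x. l * (norm x)\<^sup>2 \<le> x \<bullet> (P *v x)"
    using sym_pos_def_lower_bound[OF P] by blast
  have "((\<lambda>t. sqrt (c / l * J t)) \<longlongrightarrow> sqrt (c / l * 0)) at_top"
    by (intro tendsto_intros \<open>(J \<longlongrightarrow> 0) at_top\<close>)
  moreover have "norm (y t) \<le> sqrt (c / l * J t)" if "0 \<le> t" for t
  proof (rule real_le_rsqrt)
    have "l * (norm (y t))\<^sup>2 / c \<le> (r t)\<^sup>2 / c"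
      using l(2) c_pos by (intro divide_right_mono) (auto simp: weighted_norm_squared[OF P])
    also have "\<dots> \<le> J t"
      using barrier_ge[OF r_pos r_less[OF that]] J_nonneg[of t] by simp
    finally show "(norm (y t))\<^sup>2 \<le> c / l * J t"
      using l(1) c_pos by (simp add: field_simps)
  qed
  then have "\<forall>\<^sub>F t in at_top. norm (y t) \<le> sqrt (c / l * J t)"
    using eventually_ge_at_top[of 0] by (rule eventually_mono[rotated])
  ultimately show ?thesis
    by (intro Lim_null_comparison[of y "\<lambda>t. sqrt (c / l * J t)"]) simp_all
qed

end

subsection \<open>Stable linear systems with Lipschitz input\<close>

text \<open>\<open>K\<close> depends on the matrices only and the bound is linear in the data, so
  initial values and inputs of order \<open>s\<close> produce a response of order
  \<open>s\<close>.\<close>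

lemma lyapunov_bounded_response:
  fixes A P Q :: "real^'n^'n"
  assumes P: "sym_pos_def P" and Q: "sym_pos_def Q" and lyapunov: "transpose A ** P + P ** A = - Q"
  obtains K where "\<And>y g M t. continuous_on {0..} y \<Longrightarrow>
    (\<And>t. 0 < t \<Longrightarrow> (y has_vector_derivative A *v y t + g t) (at t)) \<Longrightarrow>
    (\<And>t. 0 < t \<Longrightarrow> norm (g t) \<le> M) \<Longrightarrow> 0 \<le> t \<Longrightarrow> norm (y t) \<le> K * (norm (y 0) + M)"
proof -
  obtain l where l: "0 < l" "\<And>x. l * (norm x)\<^sup>2 \<le> x \<bullet> (P *v x)"
    using sym_pos_def_lower_bound[OF P] by blast
  obtain q where q: "0 < q" "\<And>x. q * (norm x)\<^sup>2 \<le> x \<bullet> (Q *v x)"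
    using sym_pos_def_lower_bound[OF Q] by blast
  obtain B where B: "0 < B" "\<And>x. norm (P *v x) \<le> B * norm x"
    using matrix_vector_bound[of P] by blast
  have PB: "\<bar>x \<bullet> (P *v z)\<bar> \<le> B * norm x * norm z" for x z
  proof -
    have "\<bar>x \<bullet> (P *v z)\<bar> \<le> norm x * norm (P *v z)"
      by (rule Cauchy_Schwarz_ineq2)
    also have "\<dots> \<le> norm x * (B * norm z)"
      by (intro mult_left_mono B) simp
    finally show ?thesis
      by (simp add: mult_ac)
  qed
  have "norm (y t) \<le> sqrt (B / l) * (1 + 2 * B / q) * (norm (y 0) + M)"
    if y: "continuous_on {0..} y" "\<And>t. 0 < t \<Longrightarrow> (y has_vector_derivative A *v y t + g t) (at t)"
      and g: "\<And>t. 0 < t \<Longrightarrow> norm (g t) \<le> M" and t: "0 \<le> t" for y g M t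
  proof -
    have M: "0 \<le> M"
      using g[of 1] norm_ge_zero[of "g 1"] by linarith
    \<comment> \<open>Once \<open>norm (y u) \<ge> N\<close>, the dissipation
      \<open>q * (norm (y u))\<^sup>2\<close> dominates the input term
      \<open>2 * B * M * norm (y u)\<close>. Adding \<open>norm (y 0)\<close> makes the level cover
      the initial state as well.\<close>
    define N where "N = norm (y 0) + 2 * B * M / q"
    have N: "norm (y 0) \<le> N" "2 * B * M / q \<le> N" "0 \<le> N"
      using M B(1) q(1) by (auto simp: N_def)
    define W where "W t = y t \<bullet> (P *v y t)" for t
    have cont: "continuous_on {0..} W"
      unfolding W_def
      by (intro continuous_intros y bounded_linear.continuous_on[OF matrix_vector_mul_bounded_linear])
    have "W t \<le> B * N\<^sup>2"
    proof (rule nonincreasing_above_imp_bounded[OF cont _ _ t])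
      have "W 0 \<le> B * norm (y 0) * norm (y 0)"
        using PB[of "y 0" "y 0"] by (simp add: W_def)
      also have "\<dots> \<le> B * N * N"
        using N B(1) by (intro mult_mono) auto
      finally show "W 0 \<le> B * N\<^sup>2"
        by (simp add: power2_eq_square mult_ac)
    next
      fix s t :: real
      assume st: "0 \<le> s" "s < t" and above: "\<And>u. s < u \<Longrightarrow> u \<le> t \<Longrightarrow> B * N\<^sup>2 < W u"
      show "W t \<le> W s"
      proof (rule DERIV_nonpos_imp_decreasing_open[of s t W])
        fix u assume u: "s < u" "u < t"
        have "B * N\<^sup>2 < W u"
          using above u by simp
        also have "\<dots> \<le> B * (norm (y u))\<^sup>2"
          using PB[of "y u" "y u"] by (simp add: W_def power2_eq_square)
        finally have "N\<^sup>2 < (norm (y u))\<^sup>2"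
          using B(1) by simp
        then have "N \<le> norm (y u)"
          by (meson less_imp_le norm_ge_zero power2_less_imp_less)
        then have "q * N \<le> q * norm (y u)"
          using q(1) by simp
        moreover have "2 * B * M \<le> q * N"
          using N(2) q(1) by (simp add: field_simps)
        ultimately have "2 * B * M \<le> q * norm (y u)"
          by linarith
        then have "2 * B * M * norm (y u) \<le> q * norm (y u) * norm (y u)"
          by (intro mult_right_mono) auto
        moreover have "\<bar>y u \<bullet> (P *v g u)\<bar> \<le> B * norm (y u) * M"
        proof (rule order_trans[OF PB])
          show "B * norm (y u) * norm (g u) \<le> B * norm (y u) * M"
            using g[of u] u st B(1) by (intro mult_left_mono) auto
        qed
        moreover have "2 * (y u \<bullet> (P *v (A *v y u + g u))) = - (y u \<bullet> (Q *v y u)) + 2 * (y u \<bullet> (P *v g u))"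
          using lyapunov_form[OF lyapunov P, of "y u"]
          by (simp add: matrix_vector_right_distrib inner_add_right)
        ultimately have "2 * (y u \<bullet> (P *v (A *v y u + g u))) \<le> 0"
          using q(2)[of "y u"] by (simp add: power2_eq_square mult_ac abs_le_iff)
        moreover have "(W has_real_derivative 2 * (y u \<bullet> (P *v (A *v y u + g u)))) (at u)"
          unfolding W_def using u st by (intro quadratic_form_has_derivative[OF P] y) auto
        ultimately show "\<exists>v. (W has_real_derivative v) (at u) \<and> v \<le> 0"
          by blast
      qed (use st in \<open>auto intro: continuous_on_subset[OF cont]\<close>)
    qed
    have "norm (y t) \<le> sqrt (B / l * N\<^sup>2)"
    proof (rule real_le_rsqrt)
      have "l * (norm (y t))\<^sup>2 \<le> B * N\<^sup>2"
        using l(2)[of "y t"] \<open>W t \<le> B * N\<^sup>2\<close> by (simp add: W_def)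
      then show "(norm (y t))\<^sup>2 \<le> B / l * N\<^sup>2"
        using l(1) by (simp add: field_simps)
    qed
    also have "\<dots> = sqrt (B / l) * N"
      using N(3) by (simp only: real_sqrt_mult real_sqrt_abs abs_of_nonneg)
    also have "\<dots> \<le> sqrt (B / l) * ((1 + 2 * B / q) * (norm (y 0) + M))"
      using B(1) q(1) l(1) M by (intro mult_left_mono) (auto simp: N_def algebra_simps add_divide_distrib)
    finally show ?thesis
      by (simp add: mult_ac)
  qed
  then show ?thesis
    by (rule that)
qed

text \<open>The derivative is bounded although the input \<open>g\<close> need not be: the increments
  \<open>x (t + s) - x t\<close> solve the same equation with an input of size \<open>L * s\<close>.\<close>

lemma lyapunov_bounded_derivative:
  fixes A P Q :: "real^'n^'n"
  assumes P: "sym_pos_def P" and Q: "sym_pos_def Q" and lyapunov: "transpose A ** P + P ** A = - Q"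
    and x: "evolves x (\<lambda>t. A *v x t + g t)" and g: "L-lipschitz_on {0..} g"
  obtains C where "\<And>t. 0 \<le> t \<Longrightarrow> norm (A *v x t + g t) \<le> C"
proof -
  define f where "f t = A *v x t + g t" for t
  have x_f: "evolves x f"
    using x by (simp add: f_def[abs_def])
  have cont_x: "continuous_on {0..} x"
    by (rule evolves_continuous_on[OF x])
  have cont_f: "continuous_on {0..} f"
    unfolding f_def
    by (intro continuous_intros bounded_linear.continuous_on[OF matrix_vector_mul_bounded_linear]
        cont_x lipschitz_on_continuous_on[OF g])
  have x_derivative: "(x has_vector_derivative f t) (at t)" if "0 < t" for t
    by (rule evolves_has_vector_derivative[OF x_f that continuous_on_atLeast_isCont[OF cont_f that]])
  \<comment> \<open>The increment with step \<open>s\<close> starts from \<open>x s - x 0\<close>,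
    which is of size \<open>M * s\<close> for \<open>s \<le> 1\<close>.\<close>
  have "compact (f ` {0..1})"
    by (intro compact_continuous_image continuous_on_subset[OF cont_f]) auto
  then obtain M where M: "\<And>t. t \<in> {0..1} \<Longrightarrow> norm (f t) \<le> M"
    by (meson bounded_iff compact_imp_bounded imageI)
  have "0 \<le> M"
    using order_trans[OF norm_ge_zero M[of 0]] by simp
  obtain K where K: "\<And>y g M t. continuous_on {0..} y \<Longrightarrow>
    (\<And>t. 0 < t \<Longrightarrow> (y has_vector_derivative A *v y t + g t) (at t)) \<Longrightarrow>
    (\<And>t. 0 < t \<Longrightarrow> norm (g t) \<le> M) \<Longrightarrow> 0 \<le> t \<Longrightarrow> norm (y t) \<le> K * (norm (y 0) + M)"
    using lyapunov_bounded_response[OF P Q lyapunov] by blast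
  have increment: "norm (x (t + s) - x t) \<le> \<bar>K\<bar> * (M + L) * s" if s: "0 < s" "s \<le> 1" and t: "0 < t" for s t
  proof -
    have "norm (x (t + s) - x t) \<le> K * (norm (x (0 + s) - x 0) + L * s)"
    proof (rule K[of "\<lambda>t. x (t + s) - x t" "\<lambda>t. g (t + s) - g t"])
      show "continuous_on {0..} (\<lambda>t. x (t + s) - x t)"
        using s by (intro continuous_intros cont_x continuous_on_compose2[OF cont_x]) auto
      fix t :: real assume t: "0 < t"
      have "((\<lambda>t. t + s) has_real_derivative 1) (at t)"
        by (auto intro!: derivative_eq_intros)
      then have "((\<lambda>t. x (t + s)) has_vector_derivative f (t + s)) (at t)"
        using vector_diff_chain_at[of "\<lambda>t. t + s" 1 t x "f (t + s)"] x_derivative[of "t + s"] s t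
        by (simp add: o_def has_real_derivative_iff_has_vector_derivative)
      then have "((\<lambda>t. x (t + s) - x t) has_vector_derivative f (t + s) - f t) (at t)"
        by (intro derivative_intros x_derivative t)
      then show "((\<lambda>t. x (t + s) - x t) has_vector_derivative
          A *v (x (t + s) - x t) + (g (t + s) - g t)) (at t)"
        by (simp add: f_def algebra_simps)
      show "norm (g (t + s) - g t) \<le> L * s"
        using lipschitz_on_normD[OF g, of "t + s" t] s t by simp
    qed (use t in simp)
    also have "norm (x (0 + s) - x 0) \<le> M * s"
      using has_integral_bound[OF \<open>0 \<le> M\<close>, of f "x s - x 0" 0 s] M s evolves_has_integral[OF x_f, of 0 s]
      by (auto simp: cbox_interval)
    then have "K * (norm (x (0 + s) - x 0) + L * s) \<le> \<bar>K\<bar> * (M * s + L * s)"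
      using s lipschitz_on_nonneg[OF g] by (intro mult_mono) auto
    finally show ?thesis
      by (simp add: algebra_simps)
  qed
  \<comment> \<open>The bound on increments passes to right-hand difference quotients and, in the
    limit, to the derivative. Time 0 is covered by \<open>M\<close>, since the derivative is only
    taken at positive times.\<close>
  have "norm (f t) \<le> max M (\<bar>K\<bar> * (M + L))" if "0 \<le> t" for t
  proof (cases "t = 0")
    case False
    then have "((\<lambda>s. norm (x (t + s) - x t - s *\<^sub>R f t) / norm s) \<longlongrightarrow> 0) (at 0)"
      using x_derivative[of t] that by (simp add: has_vector_derivative_def has_derivative_at)
    then have "((\<lambda>s. norm (x (t + s) - x t - s *\<^sub>R f t) / norm s) \<longlongrightarrow> 0) (at_right 0)"
      by (rule tendsto_within_subset) simp
    moreover have "\<forall>\<^sub>F s in at_right 0. norm (x (t + s) - x t - s *\<^sub>R f t) / norm s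
        = norm ((x (t + s) - x t) /\<^sub>R s - f t)"
    proof (rule eventually_at_right_less[THEN eventually_mono])
      fix s :: real assume s: "0 < s"
      then have "(x (t + s) - x t) /\<^sub>R s - f t = (x (t + s) - x t - s *\<^sub>R f t) /\<^sub>R s"
        by (simp add: scaleR_diff_right)
      then show "norm (x (t + s) - x t - s *\<^sub>R f t) / norm s = norm ((x (t + s) - x t) /\<^sub>R s - f t)"
        using s by (simp add: divide_inverse)
    qed
    ultimately have "((\<lambda>s. norm ((x (t + s) - x t) /\<^sub>R s - f t)) \<longlongrightarrow> 0) (at_right 0)"
      by (rule Lim_transform_eventually)
    then have "((\<lambda>s. (x (t + s) - x t) /\<^sub>R s) \<longlongrightarrow> f t) (at_right 0)"
      by (rule LIM_zero_cancel[OF tendsto_norm_zero_cancel])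
    then have "((\<lambda>s. norm ((x (t + s) - x t) /\<^sub>R s)) \<longlongrightarrow> norm (f t)) (at_right 0)"
      by (rule tendsto_norm)
    moreover have "\<forall>\<^sub>F s in at_right 0. norm ((x (t + s) - x t) /\<^sub>R s) \<le> \<bar>K\<bar> * (M + L)"
      unfolding eventually_at_right_field
    proof (intro exI[of _ 1] conjI allI impI)
      fix s :: real assume s: "0 < s" "s < 1"
      then have "norm (x (t + s) - x t) \<le> \<bar>K\<bar> * (M + L) * s"
        using that False by (intro increment) auto
      moreover have "norm ((x (t + s) - x t) /\<^sub>R s) = norm (x (t + s) - x t) / s"
        using s by (simp add: divide_inverse mult.commute)
      ultimately show "norm ((x (t + s) - x t) /\<^sub>R s) \<le> \<bar>K\<bar> * (M + L)"
        using s by (simp add: pos_divide_le_eq)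
    qed simp
    ultimately have "norm (f t) \<le> \<bar>K\<bar> * (M + L)"
      by (intro tendsto_upperbound[of _ "norm (f t)" "at_right 0"]) auto
    then show ?thesis
      by simp
  qed (use M[of 0] in simp)
  then show ?thesis
    by (intro that[of "max M (\<bar>K\<bar> * (M + L))"]) (simp add: f_def)
qed

lemma isCont_adaptation:
  fixes \<phi> e :: "real \<Rightarrow> real^'n"
  assumes "isCont \<phi> t" "isCont e t" "weighted_norm P (e t) < c"
  shows "isCont (\<lambda>t. adaptation c G P b (\<phi> t) (e t)) t"
proof -
  have "isCont (\<lambda>t. weighted_norm P (e t)) t"
    unfolding weighted_norm_def
    by (intro continuous_intros assms bounded_linear.continuous[OF matrix_vector_mul_bounded_linear])
  then show ?thesis
    unfolding adaptation_def barrier'_def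
    by (intro continuous_intros assms bounded_linear.continuous[OF matrix_vector_mul_bounded_linear])
      (use assms(3) in auto)
qed

lemma evolves_adaptation_derivative:
  fixes \<phi> e :: "real \<Rightarrow> real^'n"
  assumes "evolves k (\<lambda>t. adaptation c G P b (\<phi> t) (e t))" "continuous_on {0..} \<phi>" "continuous_on {0..} e"
    and "0 < t" "weighted_norm P (e t) < c"
  shows "((\<lambda>t. k t - k\<^sub>0) has_vector_derivative adaptation c G P b (\<phi> t) (e t)) (at t)"
proof -
  have "(k has_vector_derivative adaptation c G P b (\<phi> t) (e t)) (at t)"
    by (intro evolves_has_vector_derivative[OF assms(1,4)] isCont_adaptation assms(5)
        continuous_on_atLeast_isCont[OF assms(2,4)] continuous_on_atLeast_isCont[OF assms(3,4)])
  then show ?thesis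
    by (auto intro!: derivative_eq_intros)
qed

subsection \<open>The platoon\<close>

lemma lipschitz_on_vector_2:
  fixes f g :: "real \<Rightarrow> real"
  assumes "C-lipschitz_on S f" "D-lipschitz_on S g"
  shows "(C + D)-lipschitz_on S (\<lambda>t. vector [f t, g t] :: real^2)"
proof (rule lipschitz_onI)
  fix s t assume st: "s \<in> S" "t \<in> S"
  have "dist (vector [f s, g s] :: real^2) (vector [f t, g t])
      \<le> sum (\<lambda>i. \<bar>((vector [f s, g s] :: real^2) - vector [f t, g t]) $ i\<bar>) UNIV"
    unfolding dist_norm by (rule norm_le_l1_cart)
  also have "\<dots> = dist (f s) (f t) + dist (g s) (g t)"
    by (simp add: sum_2 dist_real_def)
  also have "\<dots> \<le> (C + D) * dist s t"
    using lipschitz_onD[OF assms(1) st] lipschitz_onD[OF assms(2) st] by (simp add: algebra_simps)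
  finally show "dist (vector [f s, g s] :: real^2) (vector [f t, g t]) \<le> (C + D) * dist s t" .
qed (use assms[THEN lipschitz_on_nonneg] in simp)

lemma vector_4:
  "(vector [x, y, z, w] :: 'a::zero^4) $ 1 = x"
  "(vector [x, y, z, w] :: 'a::zero^4) $ 2 = y"
  "(vector [x, y, z, w] :: 'a::zero^4) $ 3 = z"
  "(vector [x, y, z, w] :: 'a::zero^4) $ 4 = w"
  by (simp_all add: vector_def)

text \<open>The second conclusion reproduces the hypothesis on \<open>w\<close> for the next vehicle
  and carries the induction along the platoon.\<close>

lemma follower:
  fixes x xr k :: "real \<Rightarrow> real^4" and w :: "real \<Rightarrow> real^2" and u :: "real \<Rightarrow> real"
  assumes "0 < c" and \<tau>: "0 < \<tau>" "0 < \<Lambda>" "\<theta> = \<Lambda> / \<tau>"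
    and P: "sym_pos_def P" and Q: "sym_pos_def Q"
    and lyapunov: "transpose (A_m h kp kd taubar) ** P + P ** A_m h kp kd taubar = - Q"
    and G: "sym_pos_def G"
    and w: "L-lipschitz_on {0..} w"
    and x: "evolves x (\<lambda>t. A_fol h kp kd \<tau> \<Lambda> *v x t + B_w h kd *v w t + (\<theta> * u t) *\<^sub>R B_u)"
    and xr: "evolves xr (\<lambda>t. A_m h kp kd taubar *v xr t + B_w h kd *v w t)"
    and u: "\<And>t. 0 \<le> t \<Longrightarrow> u t = k t \<bullet> x t"
    and k: "evolves k (\<lambda>t. adaptation c G P B_u (x t) (x t - xr t))"
    and initial: "weighted_norm P (x 0 - xr 0) < c"
  shows "((\<lambda>t. x t - xr t) \<longlongrightarrow> 0) at_top"
    and "\<exists>L. L-lipschitz_on {0..} (\<lambda>t. vector [x t $ 2, x t $ 4] :: real^2)"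
proof -
  define y where "y t = x t - xr t" for t
  \<comment> \<open>The ideal gain from the matching condition: the input
    \<open>k\<^sub>0 \<bullet> x\<close> turns the third row of \<open>A_fol\<close> into that of
    \<open>A_m\<close>.\<close>
  define k\<^sub>0 :: "real^4" where
    "k\<^sub>0 = vector [0, 0, (1 / \<tau> - 1 / taubar) / \<theta>, (1 / taubar - \<theta>) / \<theta>]"
  define \<eta> where "\<eta> t = \<theta> * ((k t - k\<^sub>0) \<bullet> x t)" for t
  have \<theta>: "0 < \<theta>"
    using \<tau> by simp
  have cont: "continuous_on {0..} x" "continuous_on {0..} xr" "continuous_on {0..} k"
    using x xr k by (auto intro: evolves_continuous_on)
  then have cont_y: "continuous_on {0..} y" and cont_\<eta>: "continuous_on {0..} \<eta>"
    unfolding y_def \<eta>_def by (auto intro!: continuous_intros)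
  have y: "evolves y (\<lambda>t. A_m h kp kd taubar *v y t + \<eta> t *\<^sub>R B_u)"
    unfolding y_def
  proof (rule evolves_cong[OF evolves_diff[OF x xr]])
    fix t :: real assume "0 \<le> t"
    have "\<theta> * (k\<^sub>0 \<bullet> x t) = (1 / \<tau> - 1 / taubar) * x t $ 3 + (1 / taubar - \<theta>) * x t $ 4"
      using \<theta> by (simp add: k\<^sub>0_def inner_vec_def sum_4 vector_4 field_simps)
    then have "\<eta> t = \<theta> * u t - (1 / \<tau> - 1 / taubar) * x t $ 3 - (1 / taubar - \<theta>) * x t $ 4"
      using u[OF \<open>0 \<le> t\<close>] by (simp add: \<eta>_def inner_diff_left right_diff_distrib)
    then show "A_fol h kp kd \<tau> \<Lambda> *v x t + B_w h kd *v w t + (\<theta> * u t) *\<^sub>R B_u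
        - (A_m h kp kd taubar *v xr t + B_w h kd *v w t)
      = A_m h kp kd taubar *v (x t - xr t) + \<eta> t *\<^sub>R B_u"
      using \<tau> by (simp add: vec_eq_iff forall_4 matrix_vector_mult_def sum_4 A_m_def A_fol_def B_u_def vector_4
          algebra_simps)
  qed
  \<comment> \<open>The derivative of \<open>x\<close> without the unknown input, split as
    \<open>x = xr + y\<close>: the derivative of \<open>xr\<close> is bounded by
    \<open>lyapunov_bounded_derivative\<close> even if \<open>xr\<close> is not, and
    \<open>A_m *v y\<close> is bounded because \<open>y\<close> is.\<close>
  define p where "p t = A_m h kp kd taubar *v xr t + B_w h kd *v w t + A_m h kp kd taubar *v y t" for t
  interpret adaptive_tracking c "A_m h kp kd taubar" P Q B_u y G "\<lambda>t. k t - k\<^sub>0" x \<theta>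
  proof
    show "B_u \<noteq> 0"
      by (simp add: vec_eq_iff forall_4 B_u_def vector_4)
    show "(y has_vector_derivative A_m h kp kd taubar *v y t + (\<theta> * ((k t - k\<^sub>0) \<bullet> x t)) *\<^sub>R B_u) (at t)"
      if "0 < t" for t
      unfolding \<eta>_def[symmetric]
      by (intro evolves_has_vector_derivative[OF y that] continuous_on_atLeast_isCont[OF _ that]
          continuous_intros cont_y cont_\<eta> bounded_linear.continuous_on[OF matrix_vector_mul_bounded_linear])
    show "((\<lambda>t. k t - k\<^sub>0) has_vector_derivative adaptation c G P B_u (x t) (y t)) (at t)"
      if "0 < t" "weighted_norm P (y t) < c" for t
      using that k cont_y cont by (intro evolves_adaptation_derivative) (auto simp: y_def)
  qed (use assms \<theta> cont cont_y in \<open>auto simp: y_def intro!: continuous_intros\<close>)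
  obtain Y where Y: "\<And>t. 0 \<le> t \<Longrightarrow> norm (y t) \<le> Y"
    using y_bounded by blast
  obtain B where B: "0 < B" "\<And>v. norm (A_m h kp kd taubar *v v) \<le> B * norm v"
    using matrix_vector_bound by blast
  have Ay: "norm (A_m h kp kd taubar *v y t) \<le> B * Y" if "0 \<le> t" for t
    using B Y[OF that] by (meson less_imp_le mult_left_mono order_trans)
  obtain B' where B': "0 < B'" "\<And>v. norm (B_w h kd *v v) \<le> B' * norm v"
    using matrix_vector_bound by blast
  have Bw: "(B' * L)-lipschitz_on {0..} (\<lambda>t. B_w h kd *v w t)"
  proof (rule lipschitz_onI)
    fix s t :: real assume "s \<in> {0..}" "t \<in> {0..}"
    then have "norm (w s - w t) \<le> L * norm (s - t)"
      by (rule lipschitz_on_normD[OF w])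
    then have "B' * norm (w s - w t) \<le> B' * (L * norm (s - t))"
      using B'(1) by (intro mult_left_mono) auto
    then have "norm (B_w h kd *v (w s - w t)) \<le> B' * (L * norm (s - t))"
      by (rule order_trans[OF B'(2)])
    then show "dist (B_w h kd *v w s) (B_w h kd *v w t) \<le> B' * L * dist s t"
      by (simp add: dist_norm matrix_vector_mult_diff_distrib mult.assoc)
  qed (use B'(1) lipschitz_on_nonneg[OF w] in simp)
  obtain C where C: "\<And>t. 0 \<le> t \<Longrightarrow> norm (A_m h kp kd taubar *v xr t + B_w h kd *v w t) \<le> C"
    using lyapunov_bounded_derivative[OF P Q lyapunov xr Bw] by blast
  show "((\<lambda>t. x t - xr t) \<longlongrightarrow> 0) at_top"
    unfolding y_def[symmetric]
  proof (rule tracking)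
    fix t :: real assume t: "0 < t"
    have "(xr has_vector_derivative A_m h kp kd taubar *v xr t + B_w h kd *v w t) (at t)"
      using t cont lipschitz_on_continuous_on[OF w]
      by (intro evolves_has_vector_derivative[OF xr] continuous_on_atLeast_isCont[of 0] continuous_intros
          bounded_linear.continuous_on[OF matrix_vector_mul_bounded_linear])
    from has_vector_derivative_add[OF this y_derivative[OF t]]
    have "((\<lambda>t. xr t + y t) has_vector_derivative p t + (\<theta> * ((k t - k\<^sub>0) \<bullet> x t)) *\<^sub>R B_u) (at t)"
      by (simp add: p_def add.assoc)
    then show "(x has_vector_derivative p t + (\<theta> * ((k t - k\<^sub>0) \<bullet> x t)) *\<^sub>R B_u) (at t)"
      by (simp add: y_def)
    show "norm (p t) \<le> C + B * Y"
      unfolding p_def using C[of t] Ay[of t] t by (intro norm_triangle_mono) auto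
  qed
  \<comment> \<open>The input term of the error equation, whose size is not controlled, acts along
    \<open>B_u\<close> only. The transmitted components 2 and 4 do not feel it directly.\<close>
  have component: "(C + B * Y)-lipschitz_on {0..} (\<lambda>t. x t $ i)" if "B_u $ i = 0" for i
  proof -
    have "C-lipschitz_on {0..} (\<lambda>t. xr t $ i)"
      by (rule evolves_lipschitz_on[OF evolves_nth[OF xr]])
        (simp only: real_norm_def order_trans[OF component_le_norm_cart C])
    moreover have "(B * Y)-lipschitz_on {0..} (\<lambda>t. y t $ i)"
      by (rule evolves_lipschitz_on[OF evolves_nth[OF y]])
        (simp add: that order_trans[OF component_le_norm_cart Ay])
    ultimately have "(C + B * Y)-lipschitz_on {0..} (\<lambda>t. xr t $ i + y t $ i)"
      by (rule lipschitz_on_add)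
    then show ?thesis
      by (simp add: y_def)
  qed
  show "\<exists>L. L-lipschitz_on {0..} (\<lambda>t. vector [x t $ 2, x t $ 4] :: real^2)"
    using lipschitz_on_vector_2[OF component[of 2] component[of 4]] by (auto simp: B_u_def vector_4)
qed

text \<open>The base case of the induction. It uses only that the error \<open>y\<close> is bounded.
  There are two adaptive gains with different regressors, so \<open>barrier_tracking\<close> is
  applied with the sum of their energies.\<close>

lemma leader:
  fixes x xr k kt :: "real \<Rightarrow> real^3" and u u_in :: "real \<Rightarrow> real"
  assumes pos: "0 < c" "0 < h" "0 < taubar" and \<tau>: "0 < \<tau>" "0 < \<Lambda>" "\<theta> = \<Lambda> / \<tau>"
    and P: "sym_pos_def P" and Q: "sym_pos_def Q"
    and lyapunov: "transpose (A_c h \<beta>1 \<beta>2 \<beta>3) ** P + P ** A_c h \<beta>1 \<beta>2 \<beta>3 = - Q"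
    and G: "sym_pos_def G" and Gt: "sym_pos_def Gt"
    and u_in: "bounded (u_in ` {0..})"
    and x: "evolves x (\<lambda>t. A_lead h \<tau> \<Lambda> *v x t + (\<theta> * u t) *\<^sub>R B_u0 + u_in t *\<^sub>R B_r0 h)"
    and xr: "evolves xr (\<lambda>t. A_m0 h taubar *v xr t + u_in t *\<^sub>R B_r0 h)"
    and u: "\<And>t. 0 \<le> t \<Longrightarrow> u t = k t \<bullet> x t + kt t \<bullet> (x t - xr t)"
    and k: "evolves k (\<lambda>t. adaptation c G P B_u0 (x t) (x t - xr t))"
    and kt: "evolves kt (\<lambda>t. adaptation c Gt P B_u0 (x t - xr t) (x t - xr t))"
    and initial: "weighted_norm P (x 0 - xr 0) < c"
  shows "\<exists>L. L-lipschitz_on {0..} (\<lambda>t. vector [x t $ 1, x t $ 3] :: real^2)"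
proof -
  define y where "y t = x t - xr t" for t
  \<comment> \<open>\<open>k\<^sub>0\<close> turns \<open>A_lead\<close> into \<open>A_m0\<close>,
    and \<open>kt\<^sub>0\<close> replaces \<open>A_m0\<close> by \<open>A_c\<close> in the error
    equation. The latter is required since \<open>A_m0\<close> has a zero column and thus admits no
    such Lyapunov equation.\<close>
  define k\<^sub>0 :: "real^3" where
    "k\<^sub>0 = vector [0, (1 / \<tau> - 1 / taubar) / \<theta>, (1 / taubar - \<theta>) / \<theta>]"
  define kt\<^sub>0 :: "real^3" where
    "kt\<^sub>0 = vector [\<beta>1 / \<theta>, (\<beta>2 + 1 / taubar) / \<theta>, (\<beta>3 - 1 / taubar) / \<theta>]"
  define \<eta> where "\<eta> t = \<theta> * ((k t - k\<^sub>0) \<bullet> x t + (kt t - kt\<^sub>0) \<bullet> y t)" for t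
  have \<theta>: "0 < \<theta>"
    using \<tau> by simp
  have cont: "continuous_on {0..} x" "continuous_on {0..} xr" "continuous_on {0..} k" "continuous_on {0..} kt"
    using x xr k kt by (auto intro: evolves_continuous_on)
  then have cont_y: "continuous_on {0..} y" and cont_\<eta>: "continuous_on {0..} \<eta>"
    unfolding y_def \<eta>_def by (auto intro!: continuous_intros)
  have y: "evolves y (\<lambda>t. A_c h \<beta>1 \<beta>2 \<beta>3 *v y t + \<eta> t *\<^sub>R B_u0)"
    unfolding y_def
  proof (rule evolves_cong[OF evolves_diff[OF x xr]])
    fix t :: real assume "0 \<le> t"
    have "\<theta> * (k\<^sub>0 \<bullet> x t) = (1 / \<tau> - 1 / taubar) * x t $ 2 + (1 / taubar - \<theta>) * x t $ 3"
      "\<theta> * (kt\<^sub>0 \<bullet> y t) = \<beta>1 * y t $ 1 + (\<beta>2 + 1 / taubar) * y t $ 2 + (\<beta>3 - 1 / taubar) * y t $ 3"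
      using \<theta> by (simp_all add: k\<^sub>0_def kt\<^sub>0_def inner_vec_def sum_3 distrib_left)
    then have "\<eta> t = \<theta> * u t - (1 / \<tau> - 1 / taubar) * x t $ 2 - (1 / taubar - \<theta>) * x t $ 3
      - (\<beta>1 * y t $ 1 + (\<beta>2 + 1 / taubar) * y t $ 2 + (\<beta>3 - 1 / taubar) * y t $ 3)"
      using u[OF \<open>0 \<le> t\<close>] by (simp add: \<eta>_def inner_diff_left right_diff_distrib distrib_left y_def[symmetric])
    then show "A_lead h \<tau> \<Lambda> *v x t + (\<theta> * u t) *\<^sub>R B_u0 + u_in t *\<^sub>R B_r0 h
        - (A_m0 h taubar *v xr t + u_in t *\<^sub>R B_r0 h)
      = A_c h \<beta>1 \<beta>2 \<beta>3 *v (x t - xr t) + \<eta> t *\<^sub>R B_u0"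
      using \<tau> by (simp add: vec_eq_iff forall_3 matrix_vector_mult_def sum_3 A_m0_def A_lead_def A_c_def B_u0_def
          y_def algebra_simps)
  qed
  obtain R where R: "sym_pos_def R" "\<And>v. R *v (G *v v) = v"
    using sym_pos_def_inverse[OF G] by blast
  obtain Rt where Rt: "sym_pos_def Rt" "\<And>v. Rt *v (Gt *v v) = v"
    using sym_pos_def_inverse[OF Gt] by blast
  interpret barrier_tracking c "A_c h \<beta>1 \<beta>2 \<beta>3" P Q B_u0 y \<eta>
    "\<lambda>t. \<theta> * ((k t - k\<^sub>0) \<bullet> (R *v (k t - k\<^sub>0)) + (kt t - kt\<^sub>0) \<bullet> (Rt *v (kt t - kt\<^sub>0)))"
  proof
    show "(y has_vector_derivative A_c h \<beta>1 \<beta>2 \<beta>3 *v y t + \<eta> t *\<^sub>R B_u0) (at t)" if "0 < t" for t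
      by (intro evolves_has_vector_derivative[OF y that] continuous_on_atLeast_isCont[OF _ that]
          continuous_intros cont_y cont_\<eta> bounded_linear.continuous_on[OF matrix_vector_mul_bounded_linear])
    show "continuous_on {0..} (\<lambda>t. \<theta> * ((k t - k\<^sub>0) \<bullet> (R *v (k t - k\<^sub>0)) + (kt t - kt\<^sub>0) \<bullet> (Rt *v (kt t - kt\<^sub>0))))"
      by (intro continuous_intros cont bounded_linear.continuous_on[OF matrix_vector_mul_bounded_linear])
    show "0 \<le> \<theta> * ((k t - k\<^sub>0) \<bullet> (R *v (k t - k\<^sub>0)) + (kt t - kt\<^sub>0) \<bullet> (Rt *v (kt t - kt\<^sub>0)))" for t
      using \<theta> sym_pos_def_nonneg[OF R(1)] sym_pos_def_nonneg[OF Rt(1)] by simp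
    fix t assume t: "0 < t" "weighted_norm P (y t) < c"
    have "((\<lambda>t. k t - k\<^sub>0) has_vector_derivative adaptation c G P B_u0 (x t) (y t)) (at t)"
      "((\<lambda>t. kt t - kt\<^sub>0) has_vector_derivative adaptation c Gt P B_u0 (y t) (y t)) (at t)"
      using t k kt cont_y cont by (auto intro!: evolves_adaptation_derivative simp: y_def)
    from DERIV_cmult[OF DERIV_add[OF quadratic_form_has_derivative[OF R(1) this(1)]
          quadratic_form_has_derivative[OF Rt(1) this(2)]], of \<theta>]
    show "((\<lambda>t. \<theta> * ((k t - k\<^sub>0) \<bullet> (R *v (k t - k\<^sub>0)) + (kt t - kt\<^sub>0) \<bullet> (Rt *v (kt t - kt\<^sub>0)))) has_real_derivative
      - 2 * barrier' c (weighted_norm P (y t)) * (y t \<bullet> (P *v B_u0)) * \<eta> t) (at t)"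
      by (rule DERIV_cong)
        (simp add: adaptation_def R(2) Rt(2) matrix_vector_mult_scaleR linear_neg[OF matrix_vector_mul_linear]
          \<eta>_def algebra_simps)
  qed (use assms cont_y in \<open>auto simp: y_def\<close>)
  obtain Y where Y: "\<And>t. 0 \<le> t \<Longrightarrow> norm (y t) \<le> Y"
    using y_bounded by blast
  obtain B where B: "0 < B" "\<And>v. norm (A_c h \<beta>1 \<beta>2 \<beta>3 *v v) \<le> B * norm v"
    using matrix_vector_bound by blast
  have Ay: "norm (A_c h \<beta>1 \<beta>2 \<beta>3 *v y t) \<le> B * Y" if "0 \<le> t" for t
    using B Y[OF that] by (meson less_imp_le mult_left_mono order_trans)
  have y_component: "(B * Y)-lipschitz_on {0..} (\<lambda>t. y t $ i)" if "B_u0 $ i = 0" for i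
    by (rule evolves_lipschitz_on[OF evolves_nth[OF y]])
      (simp add: that order_trans[OF component_le_norm_cart Ay])
  obtain U where U: "\<And>t. 0 \<le> t \<Longrightarrow> \<bar>u_in t\<bar> \<le> U"
    using u_in unfolding bounded_iff by auto
  \<comment> \<open>The reference leader is a chain: \<open>u_in\<close> drives the baseline control
    through a lag with time constant \<open>h\<close>, which drives the acceleration through a lag
    with time constant \<open>taubar\<close>. The velocity integrates the acceleration, so it is
    Lipschitz but possibly unbounded.\<close>
  have xr3: "evolves (\<lambda>t. xr t $ 3) (\<lambda>t. (u_in t - xr t $ 3) / h)"
    by (rule evolves_cong[OF evolves_nth[OF xr]])
      (simp add: matrix_vector_mult_def sum_3 A_m0_def A_lead_def B_r0_def diff_divide_distrib)
  obtain U\<^sub>3 where U\<^sub>3: "\<And>t. 0 \<le> t \<Longrightarrow> \<bar>xr t $ 3\<bar> \<le> U\<^sub>3"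
    using evolves_relaxation_bounded[OF xr3 pos(2) U] by blast
  have xr2: "evolves (\<lambda>t. xr t $ 2) (\<lambda>t. (xr t $ 3 - xr t $ 2) / taubar)"
    by (rule evolves_cong[OF evolves_nth[OF xr]])
      (simp add: matrix_vector_mult_def sum_3 A_m0_def A_lead_def B_r0_def diff_divide_distrib)
  obtain U\<^sub>2 where U\<^sub>2: "\<And>t. 0 \<le> t \<Longrightarrow> \<bar>xr t $ 2\<bar> \<le> U\<^sub>2"
    using evolves_relaxation_bounded[OF xr2 pos(3) U\<^sub>3] by blast
  have xr1: "evolves (\<lambda>t. xr t $ 1) (\<lambda>t. xr t $ 2)"
    by (rule evolves_cong[OF evolves_nth[OF xr]])
      (simp add: matrix_vector_mult_def sum_3 A_m0_def A_lead_def B_r0_def)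
  have "U\<^sub>2-lipschitz_on {0..} (\<lambda>t. xr t $ 1)"
    by (rule evolves_lipschitz_on[OF xr1]) (use U\<^sub>2 in simp)
  from lipschitz_on_add[OF this y_component[of 1]]
  have x1: "(U\<^sub>2 + B * Y)-lipschitz_on {0..} (\<lambda>t. x t $ 1)"
    by (simp add: y_def B_u0_def)
  have "((U + U\<^sub>3) / h)-lipschitz_on {0..} (\<lambda>t. xr t $ 3)"
  proof (rule evolves_lipschitz_on[OF xr3])
    fix t :: real assume "0 \<le> t"
    then show "norm ((u_in t - xr t $ 3) / h) \<le> (U + U\<^sub>3) / h"
      using U[of t] U\<^sub>3[of t] pos(2) by (simp add: divide_right_mono)
  qed
  from lipschitz_on_add[OF this y_component[of 3]]
  have x3: "((U + U\<^sub>3) / h + B * Y)-lipschitz_on {0..} (\<lambda>t. x t $ 3)"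
    by (simp add: y_def B_u0_def)
  show ?thesis
    using lipschitz_on_vector_2[OF x1 x3] by blast
qed

theorem theorem5:
  fixes N :: nat
    and h kp kd taubar c \<beta>1 \<beta>2 \<beta>3 :: real
    and \<tau> \<Lambda> \<theta> :: "nat \<Rightarrow> real"
    and u_in :: "real \<Rightarrow> real"
    and x xr xv kx :: "nat \<Rightarrow> real \<Rightarrow> real^4"
    and x0 xr0 xv0 kx0 kxt0 :: "real \<Rightarrow> real^3"
    and u_ad :: "nat \<Rightarrow> real \<Rightarrow> real"
    and Pm Qm :: "real^4^4" and \<Gamma>x :: "nat \<Rightarrow> real^4^4"
    and Pm0 Qc \<Gamma>x0 \<Gamma>xt0 :: "real^3^3"
  assumes N: "N \<ge> 1"
    and positive: "h > 0" "kp > 0" "kd > 0" "taubar > 0" "kd > taubar * kp" "c > 0"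
    and vehicle_params: "\<And>j. j \<in> {0..N} \<Longrightarrow> \<tau> j > 0 \<and> \<Lambda> j > 0 \<and> \<theta> j = \<Lambda> j / \<tau> j"
    and betas: "\<beta>1 < 0" "\<beta>2 < 0"
    and lyap: "sym_pos_def Pm" "sym_pos_def Qm"
      "transpose (A_m h kp kd taubar) ** Pm + Pm ** A_m h kp kd taubar = - Qm"
    and lyap0: "sym_pos_def Pm0" "sym_pos_def Qc"
      "transpose (A_c h \<beta>1 \<beta>2 \<beta>3) ** Pm0 + Pm0 ** A_c h \<beta>1 \<beta>2 \<beta>3 = - Qc"
    and gains: "\<And>j. j \<in> {1..N} \<Longrightarrow> sym_pos_def (\<Gamma>x j)"
    and gains0: "sym_pos_def \<Gamma>x0" "sym_pos_def \<Gamma>xt0"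
    and u_in_bounded: "bounded (u_in ` {0..})"
    and u_in_limit: "(u_in \<longlongrightarrow> 0) at_top \<Longrightarrow> \<exists>vc. ((\<lambda>t. xv0 t $ 1) \<longlongrightarrow> vc) at_top"
    and RP_leader: "\<And>t. t \<ge> 0 \<Longrightarrow> xr0 t = xv0 t"
      "evolves xr0 (\<lambda>t. A_m0 h taubar *v xr0 t + u_in t *\<^sub>R B_r0 h)"
    and AP_leader: "evolves x0 (\<lambda>t. A_lead h (\<tau> 0) (\<Lambda> 0) *v x0 t
      + (\<theta> 0 * u_ad 0 t) *\<^sub>R B_u0 + u_in t *\<^sub>R B_r0 h)"
    and AP: "\<And>j. j \<in> {1..N} \<Longrightarrow> evolves (x j) (\<lambda>t. A_fol h kp kd (\<tau> j) (\<Lambda> j) *v x j t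
      + B_w h kd *v w_signal x0 x (j - 1) t + (\<theta> j * u_ad j t) *\<^sub>R B_u)"
    and RP: "\<And>j. j \<in> {1..N} \<Longrightarrow> evolves (xr j) (\<lambda>t. A_m h kp kd taubar *v xr j t
      + B_w h kd *v w_signal x0 x (j - 1) t)"
    and RP_init: "\<And>j. j \<in> {1..N} \<Longrightarrow> xr j 0 = xv j 0"
    and VP: "\<And>j. j \<in> {1..N} \<Longrightarrow> evolves (xv j) (\<lambda>t. A_m h kp kd taubar *v xv j t
      + B_w h kd *v w_signal xv0 xv (j - 1) t)"
    and control: "\<And>j t. j \<in> {1..N} \<Longrightarrow> t \<ge> 0 \<Longrightarrow> u_ad j t = kx j t \<bullet> x j t"
    and control0: "\<And>t. t \<ge> 0 \<Longrightarrow> u_ad 0 t = kx0 t \<bullet> x0 t + kxt0 t \<bullet> (x0 t - xr0 t)"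
    and adapt: "\<And>j. j \<in> {1..N} \<Longrightarrow>
      evolves (kx j) (\<lambda>t. adaptation c (\<Gamma>x j) Pm B_u (x j t) (x j t - xr j t))"
    and adapt0: "evolves kx0 (\<lambda>t. adaptation c \<Gamma>x0 Pm0 B_u0 (x0 t) (x0 t - xr0 t))"
      "evolves kxt0 (\<lambda>t. adaptation c \<Gamma>xt0 Pm0 B_u0 (x0 t - xr0 t) (x0 t - xr0 t))"
    and barrier_init: "\<And>j. j \<in> {1..N} \<Longrightarrow> weighted_norm Pm (x j 0 - xr j 0) < c"
      "weighted_norm Pm0 (x0 0 - xr0 0) < c"
  shows "\<forall>j\<in>{1..N}. ((\<lambda>t. x j t - xr j t) \<longlongrightarrow> 0) at_top"
proof -
  \<comment> \<open>Induction along the string of vehicles, starting at the leader with index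
    0.\<close>
  have signal_lipschitz: "\<exists>L. L-lipschitz_on {0..} (w_signal x0 x j)" if "j \<le> N" for j
    using that
  proof (induction j)
    case 0
    have "\<exists>L. L-lipschitz_on {0..} (\<lambda>t. vector [x0 t $ 1, x0 t $ 3] :: real^2)"
      by (rule leader[OF positive(6,1,4) _ _ _ lyap0 gains0 u_in_bounded AP_leader RP_leader(2)
            control0 adapt0 barrier_init(2)])
        (use vehicle_params[of 0] in auto)
    then show ?case
      by (simp add: w_signal_def[abs_def])
  next
    case (Suc i)
    then obtain L where L: "L-lipschitz_on {0..} (w_signal x0 x i)"
      by auto
    have j: "Suc i \<in> {1..N}"
      using Suc.prems by simp
    have "\<exists>L. L-lipschitz_on {0..} (\<lambda>t. vector [x (Suc i) t $ 2, x (Suc i) t $ 4] :: real^2)"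
      by (rule follower(2)[OF positive(6) _ _ _ lyap gains[OF j] _ AP[OF j] RP[OF j]
            control[OF j] adapt[OF j] barrier_init(1)[OF j]])
        (use vehicle_params[of "Suc i"] j L in auto)
    then show ?case
      by (simp add: w_signal_def[abs_def])
  qed
  show ?thesis
  proof
    fix j assume j: "j \<in> {1..N}"
    then have "j - 1 \<le> N"
      by auto
    then obtain L where "L-lipschitz_on {0..} (w_signal x0 x (j - 1))"
      using signal_lipschitz by blast
    then show "((\<lambda>t. x j t - xr j t) \<longlongrightarrow> 0) at_top"
      by (intro follower(1)[OF positive(6) _ _ _ lyap gains[OF j] _ AP[OF j] RP[OF j]
            control[OF j] adapt[OF j] barrier_init(1)[OF j]])
        (use vehicle_params[of j] j in auto)
  qed
qed

end
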